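(* Let $\hat\epsilon\ge\epsilon>0$, $a\in\{0,1\}$, $0<\beta<1/2$, and integers $1\le m\le n$ be given. Let $\rho$ be a density operator on $\mathcal{H}_2^{\otimes(m+n)}$ ($\mathcal{H}_2=\mathbb{C}^2$). Let $M=\{|\mu_0\rangle\langle\mu_0|,|\mu_1\rangle\langle\mu_1|\}$ and $N=\{|\nu_0\rangle\langle\nu_0|,|\nu_1\rangle\langle\nu_1|\}$ be two projective measurements on $\mathcal{H}_2$ (so $\{|\mu_0\rangle,|\mu_1\rangle\}$ and $\{|\nu_0\rangle,|\nu_1\rangle\}$ are orthonormal bases), and let $c=\max_{x,y\in\{0,1\}}|\langle\mu_x|\nu_y\rangle|^2$. Consider the following experiment: a subset $t\subset\{1,\dots,m+n\}$ with $|t|=m$ is chosen uniformly at random among all $\binom{m+n}{m}$ such subsets, and each of the $m$ qubits indexed by $t$ is measured with $M$, giving an outcome string $q\in\{0,1\}^m$; let $\rho(t,q)$ denote the resulting normalized post-measurement state of the remaining $n$ qubits. Set $$\delta=\sqrt{\frac{(m+n+2)\ln(2/\epsilon^2)}{m(m+n)}}.$$ Then, with probability at least $1-\hat\epsilon^{\,1-2\beta}$ over the choice of $t$ and the measurement outcome $q$, $$H_\infty^{2\epsilon+2\epsilon^\beta}(N)_{\rho(t,q)}+n\,\bar H\big(w_a(q)+\delta\big)\ \ge\ -n\log_2 c .$$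
   Context: All logarithms are base 2. For a string $q$ over an alphabet and a letter $a$, the relative $a$-Hamming weight is $w_a(q)=|\{i: q_i\ne a\}|/|q|$. The extended binary entropy is $\bar H(x)=-x\log_2 x-(1-x)\log_2(1-x)$ for $x\in[0,1/2]$, $\bar H(x)=0$ for $x<0$, and $\bar H(x)=1$ for $x>1/2$. For a state $\sigma$ on $\mathcal{H}_2^{\otimes n}$, $H_\infty(N)_\sigma=-\log_2\max_{j\in\{0,1\}^n}p_\sigma(j)$, where $p_\sigma(j)=\langle\nu_{j_1}\cdots\nu_{j_n}|\sigma|\nu_{j_1}\cdots\nu_{j_n}\rangle$ is the probability of outcome $j$ when each of the $n$ qubits is measured with $N$. The smooth version is $H_\infty^{\epsilon'}(N)_\rho=\sup\{H_\infty(N)_\sigma:\ \sigma \text{ a density operator on }\mathcal{H}_2^{\otimes n},\ \|\sigma-\rho\|_1\le\epsilon'\}$, where $\|\cdot\|_1$ is the trace norm. *)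

theory Defs
  imports Complex_Main "HOL-Library.FuncSet" "Jordan_Normal_Form.Schur_Decomposition"
begin

text \<open>Operators on the n-qubit space (C^2)^{tensor n} are complex 2^n x 2^n matrices.
  A computational basis index i < 2^n encodes the bit string whose l-th bit
  (qubit l, l < n) is bit_of i l.\<close>

definition bit_of :: "nat \<Rightarrow> nat \<Rightarrow> nat" where
  "bit_of i l = (i div 2 ^ l) mod 2"

definition mtrace :: "complex mat \<Rightarrow> complex" where
  "mtrace A = (\<Sum>i<dim_row A. A $$ (i, i))"

definition density_op :: "nat \<Rightarrow> complex mat \<Rightarrow> bool" where
  "density_op k \<rho> \<longleftrightarrow> \<rho> \<in> carrier_mat (2 ^ k) (2 ^ k) \<and>
     (\<forall>v :: nat \<Rightarrow> complex.
        let z = (\<Sum>i<2 ^ k. \<Sum>j<2 ^ k. cnj (v i) * \<rho> $$ (i, j) * v j)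
        in Im z = 0 \<and> Re z \<ge> 0) \<and>
     mtrace \<rho> = 1"

text \<open>Trace norm: ||X||_1 = Tr sqrt(X^* X) = sum of singular values, i.e. the sum of the
  square roots of the eigenvalues of X^* X, counted with algebraic multiplicity.\<close>
definition trace_norm :: "complex mat \<Rightarrow> real" where
  "trace_norm X = (let p = char_poly (mat_adjoint X * X) in
     (\<Sum>z\<in>{z. poly p z = 0}. real (order z p) * sqrt (cmod z)))"

text \<open>A vector in C^2 is a function nat => complex (components 0,1).
  A projective measurement {|b_0><b_0|, |b_1><b_1|} is given by an orthonormal basis b 0, b 1.\<close>
definition inner2 :: "(nat \<Rightarrow> complex) \<Rightarrow> (nat \<Rightarrow> complex) \<Rightarrow> complex" where
  "inner2 u v = (\<Sum>k<2. cnj (u k) * v k)"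

definition onb2 :: "(nat \<Rightarrow> nat \<Rightarrow> complex) \<Rightarrow> bool" where
  "onb2 b \<longleftrightarrow> (\<forall>x<2. \<forall>y<2. inner2 (b x) (b y) = (if x = y then 1 else 0))"

definition overlap :: "(nat \<Rightarrow> nat \<Rightarrow> complex) \<Rightarrow> (nat \<Rightarrow> nat \<Rightarrow> complex) \<Rightarrow> real" where
  "overlap M N = Max {(cmod (inner2 (M x) (N y)))\<^sup>2 | x y. x < 2 \<and> y < 2}"

text \<open>Computational-basis index of the (m+n)=K qubit string that has bit x j on qubit j \<in> t
  and, on the remaining qubits r_0 < r_1 < ... (the elements of {0..<K} - t in increasing
  order), the bits of i.\<close>
definition merge_idx :: "nat \<Rightarrow> nat set \<Rightarrow> (nat \<Rightarrow> nat) \<Rightarrow> nat \<Rightarrow> nat" where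
  "merge_idx K t x i =
     (\<Sum>j\<in>t. x j * 2 ^ j) +
     (\<Sum>l<card ({0..<K} - t). bit_of i l * 2 ^ (sorted_list_of_set ({0..<K} - t) ! l))"

text \<open>Unnormalised post-measurement state of the remaining qubits, after measuring each qubit
  j \<in> t with the measurement M and obtaining outcome q j:
  (<M_q| \<otimes> I) \<rho> (|M_q> \<otimes> I).\<close>
definition post_unnorm ::
  "nat \<Rightarrow> complex mat \<Rightarrow> (nat \<Rightarrow> nat \<Rightarrow> complex) \<Rightarrow> nat set \<Rightarrow> (nat \<Rightarrow> nat) \<Rightarrow> complex mat" where
  "post_unnorm K \<rho> M t q = mat (2 ^ (K - card t)) (2 ^ (K - card t)) (\<lambda>(i, i').
     \<Sum>x\<in>t \<rightarrow>\<^sub>E {0, 1}. \<Sum>x'\<in>t \<rightarrow>\<^sub>E {0, 1}.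
       (\<Prod>j\<in>t. cnj (M (q j) (x j)) * M (q j) (x' j)) *
       \<rho> $$ (merge_idx K t x i, merge_idx K t x' i'))"

definition meas_prob ::
  "nat \<Rightarrow> complex mat \<Rightarrow> (nat \<Rightarrow> nat \<Rightarrow> complex) \<Rightarrow> nat set \<Rightarrow> (nat \<Rightarrow> nat) \<Rightarrow> real" where
  "meas_prob K \<rho> M t q = Re (mtrace (post_unnorm K \<rho> M t q))"

definition post_state ::
  "nat \<Rightarrow> complex mat \<Rightarrow> (nat \<Rightarrow> nat \<Rightarrow> complex) \<Rightarrow> nat set \<Rightarrow> (nat \<Rightarrow> nat) \<Rightarrow> complex mat" where
  "post_state K \<rho> M t q = complex_of_real (1 / meas_prob K \<rho> M t q) \<cdot>\<^sub>m post_unnorm K \<rho> M t q"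

definition outcome_prob :: "nat \<Rightarrow> (nat \<Rightarrow> nat \<Rightarrow> complex) \<Rightarrow> complex mat \<Rightarrow> nat \<Rightarrow> real" where
  "outcome_prob n N \<sigma> j =
     (let v = (\<lambda>i. \<Prod>l<n. N (bit_of j l) (bit_of i l))
      in Re (\<Sum>i<2 ^ n. \<Sum>i'<2 ^ n. cnj (v i) * \<sigma> $$ (i, i') * v i'))"

definition Hmin :: "nat \<Rightarrow> (nat \<Rightarrow> nat \<Rightarrow> complex) \<Rightarrow> complex mat \<Rightarrow> real" where
  "Hmin n N \<sigma> = - log 2 (Max {outcome_prob n N \<sigma> j | j. j < 2 ^ n})"

definition Hmin_smooth :: "nat \<Rightarrow> real \<Rightarrow> (nat \<Rightarrow> nat \<Rightarrow> complex) \<Rightarrow> complex mat \<Rightarrow> real" where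
  "Hmin_smooth n eps' N \<rho> =
     Sup {Hmin n N \<sigma> | \<sigma>. density_op n \<sigma> \<and> trace_norm (\<sigma> - \<rho>) \<le> eps'}"

definition rel_weight :: "nat \<Rightarrow> nat set \<Rightarrow> (nat \<Rightarrow> nat) \<Rightarrow> real" where
  "rel_weight a t q = real (card {i \<in> t. q i \<noteq> a}) / real (card t)"

definition Hbar :: "real \<Rightarrow> real" where
  "Hbar x = (if x < 0 then 0 else if x > 1/2 then 1 else if x = 0 then 0
             else - x * log 2 x - (1 - x) * log 2 (1 - x))"

end

theory Submission
  imports Defs "HOL-Probability.Hoeffding"
begin

text \<open>
  Fix the sample \<open>t\<close> and the outcome \<open>q\<close>, and let \<open>\<Pi>\<close> project the remaining qubits onto the span of the
  \<open>M\<close>-basis strings whose relative \<open>a\<close>-weight is at most \<open>w\<^sub>a(q) + \<delta>\<close>. The smoothing state is the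
  normalised compression \<open>\<Pi> \<rho>(t,q) \<Pi>\<close>. A Hamming ball contains at most \<open>2 powr (n Hbar(w\<^sub>a(q) + \<delta>))\<close> strings,
  and each of them overlaps each \<open>N\<close>-string by at most \<open>c ^ n\<close>, which bounds its min-entropy. If \<open>\<gamma>\<close> denotes the
  probability of leaving the range of \<open>\<Pi>\<close>, then \<open>\<rho>(t,q)\<close> is within \<open>2 sqrt \<gamma> + 2 \<gamma>\<close> of the smoothing state.
  The average of \<open>\<gamma>\<close> over \<open>(t,q)\<close> is the probability that a uniformly random sample of the classical string obtained
  by measuring all \<open>m + n\<close> qubits with \<open>M\<close> underestimates the weight of the rest by more than \<open>\<delta>\<close>; by Serfling's
  inequality it is at most \<open>\<epsilon>\<^sup>2 / 2\<close>, and Markov's inequality gives \<open>\<gamma> \<le> \<epsilon> powr (1 + 2 \<beta>)\<close> outside an event of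
  probability \<open>\<epsilon> powr (1 - 2 \<beta>)\<close>.
\<close>

unbundle no vec_syntax
hide_type (open) Finite_Cartesian_Product.vec
hide_const (open) Finite_Cartesian_Product.mat Coset.order

subsection \<open>Sampling without replacement\<close>

text \<open>Hoeffding's lemma for a single draw: the logarithm of the left side is the cumulant
  generating function \<open>- h * p + ln (1 + p * (exp h - 1))\<close> of a centred Bernoulli
  variable, whose second derivative is at most 1/4.\<close>

lemma bernoulli_mgf_le:
  fixes h p :: real
  assumes "0 \<le> h" "0 \<le> p" "p \<le> 1"
  shows "p * exp (h * (1 - p)) + (1 - p) * exp (- h * p) \<le> exp (h\<^sup>2 / 8)"
proof -
  have pos: "1 + p * (exp h - 1) > 0"
    using assms by (intro add_pos_nonneg mult_nonneg_nonneg) auto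
  have "- h * p + ln (1 + p * (exp h - 1)) \<le> h\<^sup>2 / 8"
    using assms by (intro Hoeffdings_lemma_aux) auto
  then have "exp (- h * p + ln (1 + p * (exp h - 1))) \<le> exp (h\<^sup>2 / 8)"
    by simp
  also have "exp (- h * p + ln (1 + p * (exp h - 1))) = exp (- h * p) * (1 + p * (exp h - 1))"
    using pos by (subst exp_add) simp
  also have "\<dots> = p * exp (h * (1 - p)) + (1 - p) * exp (- h * p)"
    by (simp add: algebra_simps exp_add[symmetric])
  finally show ?thesis .
qed

text \<open>Double counting of the pairs \<open>(t, x)\<close> with \<open>x \<in> t\<close>. This
  conditions a uniform sample on one of its elements, which is the induction step of the moment
  bound below.\<close>

lemma sum_subsets_by_element:
  fixes f :: "'a set \<Rightarrow> real"
  assumes "finite A"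
  shows "real (Suc m) * (\<Sum>t | t \<subseteq> A \<and> card t = Suc m. f t)
       = (\<Sum>x\<in>A. \<Sum>t | t \<subseteq> A - {x} \<and> card t = m. f (insert x t))"
proof -
  have fin: "finite t" if "t \<subseteq> A" for t
    using that assms finite_subset by blast
  have finS: "finite {t. t \<subseteq> B \<and> card t = k}" if "B \<subseteq> A" for B k
    using finite_subset[of _ "Pow A"] assms that by (metis (no_types, lifting) PowI finite_Pow_iff mem_Collect_eq subsetI subset_trans)
  have "(\<Sum>x\<in>A. \<Sum>t | t \<subseteq> A - {x} \<and> card t = m. f (insert x t))
      = (\<Sum>(x, t)\<in>Sigma A (\<lambda>x. {t. t \<subseteq> A - {x} \<and> card t = m}). f (insert x t))"
    using assms by (subst sum.Sigma) (auto intro!: finS)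
  also have "\<dots> = (\<Sum>(t, x)\<in>Sigma {t. t \<subseteq> A \<and> card t = Suc m} (\<lambda>t. t). f t)"
    by (rule sum.reindex_bij_witness[where i = "\<lambda>(t, x). (x, t - {x})" and j = "\<lambda>(x, t). (insert x t, x)"])
       (auto simp: insert_absorb card_Diff_singleton subset_Diff_insert dest: fin intro!: card_insert_disjoint)
  also have "\<dots> = (\<Sum>t | t \<subseteq> A \<and> card t = Suc m. \<Sum>x\<in>t. f t)"
    using assms by (subst sum.Sigma) (auto intro!: finS fin)
  also have "\<dots> = (\<Sum>t | t \<subseteq> A \<and> card t = Suc m. real (Suc m) * f t)"
    by (intro sum.cong) auto
  finally show ?thesis
    by (simp add: sum_distrib_left)
qed

text \<open>Serfling's bound: drawing one element at a time, the centred count of the sample decomposes into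
  a centred Bernoulli step of amplitude \<open>n / (m + n - 1)\<close> and the centred count of a sample of size \<open>m - 1\<close>
  from the remaining population.\<close>
lemma sampling_mgf_le:
  fixes l :: real
  assumes "finite A" "card A = m + n" "B \<subseteq> A" "1 \<le> n" "0 \<le> l"
  shows "(\<Sum>t | t \<subseteq> A \<and> card t = m. exp (l * (real (card (t \<inter> B)) - real m * real (card B) / real (m + n))))
       \<le> real ((m + n) choose m) * exp (l\<^sup>2 / 8 * (real m * (real n + 1) / real (m + n)))"
  using assms
proof (induction m arbitrary: A B)
  case 0
  have "{t. t \<subseteq> A \<and> card t = 0} = {{}}"
    using 0 finite_subset[OF _ \<open>finite A\<close>] by auto
  then show ?case by simp
next
  case (Suc m)
  \<comment> \<open>\<open>K\<close> is the size of the population after one draw,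
    \<open>\<mu>\<close> the mean of that draw, \<open>h\<close> the parameter at which its moment
    generating function is evaluated, and \<open>V\<close> the variance factor of the induction
    hypothesis.\<close>
  define K where "K = m + n"
  define \<mu> where "\<mu> = real (card B) / (real K + 1)"
  define h where "h = l * real n / real K"
  define V where "V = real m * (real n + 1) / real K"
  have K: "K \<ge> 1" "Suc m + n = Suc K" using Suc.prems by (auto simp: K_def)
  have finB: "finite B" using Suc.prems finite_subset by blast
  have cB: "card B \<le> Suc K" using Suc.prems K by (metis card_mono)
  have \<mu>: "0 \<le> \<mu>" "\<mu> \<le> 1" using cB by (auto simp: \<mu>_def)
  have h: "0 \<le> h" using Suc.prems by (simp add: h_def)
  let ?g = "\<lambda>x. if x \<in> B then 1 else 0 :: real"
  let ?f = "\<lambda>t. exp (l * (real (card (t \<inter> B)) - real (Suc m) * real (card B) / real (Suc m + n)))"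
  have inner: "(\<Sum>t | t \<subseteq> A - {x} \<and> card t = m. ?f (insert x t))
     \<le> exp (h * (?g x - \<mu>)) * (real (K choose m) * exp (l\<^sup>2 / 8 * V))" if x: "x \<in> A" for x
  proof -
    have cx: "real (card (B - {x})) = real (card B) - ?g x"
      using finB by (cases "card B") (auto simp: card_Diff_singleton_if)
    have "?f (insert x t) = exp (h * (?g x - \<mu>)) *
        exp (l * (real (card (t \<inter> (B - {x}))) - real m * real (card (B - {x})) / real (m + n)))"
      if t: "t \<subseteq> A - {x}" "card t = m" for t
    proof -
      have fint: "finite t" using t Suc.prems finite_subset by blast
      have eq: "t \<inter> (B - {x}) = t \<inter> B" using t by auto
      have "x \<notin> t" using t by auto
      then have c: "real (card (insert x t \<inter> B)) = ?g x + real (card (t \<inter> B))"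
        using fint by (simp add: Int_insert_left)
      \<comment> \<open>Removing an \<open>x \<in> B\<close> from the population lowers the expected
        count of the other \<open>m\<close> draws by \<open>m / K\<close>, so the net effect of
        drawing it is \<open>1 - m / K = n / K\<close>.\<close>
      have e: "?g x + s - real (Suc m) * real (card B) / real (Suc m + n)
          = real n / real K * (?g x - \<mu>) + (s - real m * (real (card B) - ?g x) / real K)" for s
      proof -
        define b where "b = real (card B)"
        define g where "g = ?g x"
        have n: "real n = real K - real m" by (simp add: K_def)
        have "real K > 0" using K by simp
        then have "g + s - (real m + 1) * b / (real K + 1)
          = (real K - real m) / real K * (g - b / (real K + 1)) + (s - real m * (b - g) / real K)"
          by (simp add: divide_simps add_eq_0_iff) (simp add: algebra_simps)
        then show ?thesis
          unfolding b_def[symmetric] g_def[symmetric] \<mu>_def K(2) n by (simp add: add.commute)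
      qed
      have "?f (insert x t) = exp (l * (real n / real K * (?g x - \<mu>)
            + (real (card (t \<inter> B)) - real m * (real (card B) - ?g x) / real K)))"
        unfolding c e ..
      also have "\<dots> = exp (h * (?g x - \<mu>)) * exp (l * (real (card (t \<inter> B)) - real m * (real (card B) - ?g x) / real K))"
        unfolding h_def exp_add[symmetric] by (simp add: distrib_left)
      finally show ?thesis unfolding eq cx K_def .
    qed
    then have "(\<Sum>t | t \<subseteq> A - {x} \<and> card t = m. ?f (insert x t)) = exp (h * (?g x - \<mu>)) *
        (\<Sum>t | t \<subseteq> A - {x} \<and> card t = m. exp (l * (real (card (t \<inter> (B - {x}))) - real m * real (card (B - {x})) / real (m + n))))"
      by (simp add: sum_distrib_left)
    also have "\<dots> \<le> exp (h * (?g x - \<mu>)) * (real (K choose m) * exp (l\<^sup>2 / 8 * V))"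
      using Suc.IH[of "A - {x}" "B - {x}"] Suc.prems x unfolding K_def V_def
      by (intro mult_left_mono) (auto simp: card_Diff_singleton)
    finally show ?thesis .
  qed
  have sumg: "(\<Sum>x\<in>A. exp (h * (?g x - \<mu>))) \<le> (real K + 1) * exp (h\<^sup>2 / 8)"
  proof -
    have "(\<Sum>x\<in>A. exp (h * (?g x - \<mu>))) = (\<Sum>x\<in>B. exp (h * (1 - \<mu>))) + (\<Sum>x\<in>A - B. exp (- h * \<mu>))"
      using Suc.prems by (subst sum.subset_diff[of B A]) (auto simp: add.commute intro!: arg_cong2[where f = "(+)"] sum.cong)
    also have "\<dots> = real (card B) * exp (h * (1 - \<mu>)) + (real K + 1 - real (card B)) * exp (- h * \<mu>)"
      using Suc.prems K cB finB by (simp add: card_Diff_subset of_nat_diff)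
    also have "\<dots> = (real K + 1) * (\<mu> * exp (h * (1 - \<mu>)) + (1 - \<mu>) * exp (- h * \<mu>))"
    proof -
      have "real (card B) = (real K + 1) * \<mu>" by (simp add: \<mu>_def)
      then show ?thesis by (simp add: algebra_simps)
    qed
    also have "\<dots> \<le> (real K + 1) * exp (h\<^sup>2 / 8)"
      using bernoulli_mgf_le[OF h \<mu>] by (intro mult_left_mono) auto
    finally show ?thesis .
  qed
  have "real (Suc m) * (\<Sum>t | t \<subseteq> A \<and> card t = Suc m. ?f t)
      \<le> (\<Sum>x\<in>A. exp (h * (?g x - \<mu>)) * (real (K choose m) * exp (l\<^sup>2 / 8 * V)))"
    unfolding sum_subsets_by_element[OF Suc.prems(1)] by (intro sum_mono inner)
  also have "\<dots> = (\<Sum>x\<in>A. exp (h * (?g x - \<mu>))) * (real (K choose m) * exp (l\<^sup>2 / 8 * V))"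
    by (simp add: sum_distrib_right)
  also have "\<dots> \<le> (real K + 1) * exp (h\<^sup>2 / 8) * (real (K choose m) * exp (l\<^sup>2 / 8 * V))"
    by (intro mult_right_mono sumg) auto
  also have "\<dots> = real (Suc K * (K choose m)) * exp (h\<^sup>2 / 8 + l\<^sup>2 / 8 * V)"
    by (simp add: exp_add algebra_simps)
  also have "Suc K * (K choose m) = Suc m * (Suc K choose Suc m)"
    by (simp only: Suc_times_binomial_eq mult.commute[of "Suc m"])
  also have "real (Suc m * (Suc K choose Suc m)) * exp (h\<^sup>2 / 8 + l\<^sup>2 / 8 * V)
      \<le> real (Suc m * (Suc K choose Suc m)) * exp (l\<^sup>2 / 8 * (real (Suc m) * (real n + 1) / real (Suc m + n)))"
  proof -
    \<comment> \<open>Each draw adds the square of its amplitude to the variance factor. The closed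
      form absorbs this with slack \<open>n * m / (K\<^sup>2 * (K + 1))\<close>.\<close>
    have *: "(real n / real K)\<^sup>2 + V \<le> real (Suc m) * (real n + 1) / real (Suc m + n)"
    proof -
      have Kn: "real K = real m + real n" by (simp add: K_def)
      have pos: "real K > 0" using K by simp
      have "real (Suc m) * (real n + 1) / real (Suc m + n) - V - (real n / real K)\<^sup>2
          = real n * real m / ((real K)\<^sup>2 * (real K + 1))"
        using pos unfolding V_def K(2)
        by (simp add: divide_simps add_eq_0_iff power2_eq_square) (simp add: Kn algebra_simps)
      moreover have "\<dots> \<ge> 0" by simp
      ultimately show ?thesis by linarith
    qed
    have "h\<^sup>2 / 8 + l\<^sup>2 / 8 * V = l\<^sup>2 / 8 * ((real n / real K)\<^sup>2 + V)"
      by (simp add: h_def power_mult_distrib power_divide algebra_simps)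
    also have "\<dots> \<le> l\<^sup>2 / 8 * (real (Suc m) * (real n + 1) / real (Suc m + n))"
      by (intro mult_left_mono *) simp
    finally show ?thesis by (intro mult_left_mono) auto
  qed
  finally have "real (Suc m) * (\<Sum>t | t \<subseteq> A \<and> card t = Suc m. ?f t)
      \<le> real (Suc m) * (real (Suc K choose Suc m) * exp (l\<^sup>2 / 8 * (real (Suc m) * (real n + 1) / real (Suc m + n))))"
    by (simp only: mult.assoc of_nat_mult)
  then show ?case
    unfolding K(2) by (simp only: mult_le_cancel_left_pos of_nat_0_less_iff zero_less_Suc)
qed

text \<open>Chernoff's method applied to the moment bound. A gap of \<open>\<delta>\<close> between
  the frequencies of \<open>B\<close> in the sample and in the rest means that the sample count
  exceeds its mean by \<open>\<delta> * m * n / K\<close>, because the mean averages over both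
  parts.\<close>

lemma sampling_tail_le:
  fixes \<delta> :: real
  assumes A: "finite A" "card A = m + n" "B \<subseteq> A" and mn: "1 \<le> m" "m \<le> n" and \<delta>: "0 \<le> \<delta>"
  shows "real (card {t. t \<subseteq> A \<and> card t = m \<and>
             real (card (t \<inter> B)) / real m > real (card (B - t)) / real n + \<delta>})
       \<le> real ((m + n) choose m) * exp (- \<delta>\<^sup>2 * (real m * real (m + n)) / (real (m + n) + 2))"
proof -
  define K where "K = m + n"
  define V where "V = real m * (real n + 1) / real K"
  define r where "r = \<delta> * real m * real n / real K"
  \<comment> \<open>The minimiser of the exponent \<open>l\<^sup>2 / 8 * V - l * r\<close>, with
    minimum \<open>- 2 * r\<^sup>2 / V\<close>.\<close>
  define l where "l = 4 * r / V"
  have pos: "real m > 0" "real n > 0" "real K > 0" "V > 0"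
    using mn by (auto simp: K_def V_def)
  have l: "0 \<le> l" using pos \<delta> by (auto simp: l_def r_def)
  have finS: "finite {t. t \<subseteq> A \<and> card t = m}"
    using A(1) by (auto intro: finite_subset[of _ "Pow A"])
  let ?X = "{t. t \<subseteq> A \<and> card t = m \<and> real (card (t \<inter> B)) / real m > real (card (B - t)) / real n + \<delta>}"
  let ?d = "\<lambda>t. real (card (t \<inter> B)) - real m * real (card B) / real K"
  have dev: "1 \<le> exp (l * ?d t - l * r)" if "t \<in> ?X" for t
  proof -
    define s where "s = real (card (t \<inter> B))"
    define u where "u = real (card (B - t))"
    have "finite B" using A finite_subset by blast
    then have B: "real (card B) = s + u"
      unfolding s_def u_def by (metis Int_commute card_Int_Diff of_nat_add)
    have "s / real m > u / real n + \<delta>" using that by (simp add: s_def u_def)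
    then have "s * real n > u * real m + \<delta> * real m * real n"
      using pos by (simp add: field_simps)
    moreover have "?d t = (s * real n - u * real m) / real K"
      unfolding B s_def[symmetric] using pos by (simp add: field_simps) (simp add: K_def algebra_simps)
    ultimately have "?d t \<ge> r"
      unfolding r_def using pos by (simp add: divide_right_mono)
    then have "l * r \<le> l * ?d t" using l by (intro mult_left_mono)
    then show ?thesis by simp
  qed
  have "real (card ?X) = (\<Sum>t\<in>?X. 1)" by simp
  also have "\<dots> \<le> (\<Sum>t\<in>?X. exp (l * ?d t - l * r))"
    by (intro sum_mono dev)
  also have "\<dots> \<le> (\<Sum>t | t \<subseteq> A \<and> card t = m. exp (l * ?d t - l * r))"
    by (intro sum_mono2 finS) auto
  also have "\<dots> = exp (- l * r) * (\<Sum>t | t \<subseteq> A \<and> card t = m. exp (l * ?d t))"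
    by (simp add: sum_distrib_left exp_add[symmetric])
  also have "\<dots> \<le> exp (- l * r) * (real (K choose m) * exp (l\<^sup>2 / 8 * V))"
    using sampling_mgf_le[of A m n B l] A mn l unfolding K_def V_def
    by (intro mult_left_mono) auto
  also have "\<dots> = real (K choose m) * exp (l\<^sup>2 / 8 * V - l * r)"
    by (simp add: exp_add[symmetric] algebra_simps)
  also have "l\<^sup>2 / 8 * V - l * r = - 2 * r\<^sup>2 / V"
    using pos unfolding l_def by (simp add: field_simps power2_eq_square)
  also have "\<dots> = - \<delta>\<^sup>2 * (real m * (2 * (real n)\<^sup>2 / (real K * (real n + 1))))"
    using pos unfolding r_def V_def by (simp add: power2_eq_square power_divide power_mult_distrib)
  also have "\<dots> \<le> - \<delta>\<^sup>2 * (real m * (real K / (real K + 2)))"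
  proof -
    \<comment> \<open>\<open>m \<le> n\<close> makes \<open>2 * n - K\<close> nonnegative, and this
      is a factor of the difference of the two sides once the denominators are cleared.\<close>
    have k2: "real K \<le> 2 * real n" using mn by (simp add: K_def)
    have "real K * real K * (real n + 1) \<le> 2 * (real n)\<^sup>2 * (real K + 2)"
    proof -
      have "2 * (real n)\<^sup>2 * (real K + 2) - real K * real K * (real n + 1)
          = (2 * real n - real K) * (real n * real K + 2 * real n + real K)"
        by (simp add: algebra_simps power2_eq_square)
      moreover have "\<dots> \<ge> 0" using k2 by (intro mult_nonneg_nonneg) auto
      ultimately show ?thesis by linarith
    qed
    then have "real K / (real K + 2) \<le> 2 * (real n)\<^sup>2 / (real K * (real n + 1))"
      using pos by (simp add: divide_simps mult.assoc mult.left_commute)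
    then have "\<delta>\<^sup>2 * (real m * (real K / (real K + 2))) \<le> \<delta>\<^sup>2 * (real m * (2 * (real n)\<^sup>2 / (real K * (real n + 1))))"
      by (intro mult_left_mono) auto
    then show ?thesis by (simp only: mult_minus_left neg_le_iff_le)
  qed
  finally show ?thesis by (simp add: K_def mult_left_mono)
qed

text \<open>Weight each subset by its probability when every element is included independently with
  probability \<open>x\<close>. For \<open>0 < x \<le> 1/2\<close> each set of the ball has weight
  at least \<open>2 powr (- real (card A) * Hbar x)\<close>, and the weights of all subsets sum to
  1. For \<open>x > 1/2\<close> all subsets are counted, and for \<open>x = 0\<close> only the empty
  set remains.\<close>

lemma card_hamming_ball_le:
  fixes x :: real
  assumes "finite A" "0 \<le> x"
  shows "real (card {S. S \<subseteq> A \<and> real (card S) \<le> real (card A) * x}) \<le> 2 powr (real (card A) * Hbar x)"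
proof -
  let ?n = "card A"
  let ?X = "{S. S \<subseteq> A \<and> real (card S) \<le> real ?n * x}"
  have finX: "finite ?X" using assms(1) by (auto intro: finite_subset[of _ "Pow A"])
  consider "x = 0" | "x > 1/2" | "0 < x" "x \<le> 1/2" using assms by linarith
  then show ?thesis
  proof cases
    case 1
    then have "?X = {{}}" using assms(1) by (auto simp: card_eq_0_iff dest: finite_subset)
    then show ?thesis using 1 by (simp add: Hbar_def)
  next
    case 2
    have "card ?X \<le> card (Pow A)" using assms(1) by (intro card_mono) auto
    also have "\<dots> = 2 ^ ?n" using assms(1) by (simp add: card_Pow)
    finally have "real (card ?X) \<le> 2 ^ ?n" by (metis of_nat_le_iff of_nat_numeral of_nat_power)
    then show ?thesis using 2 by (simp add: Hbar_def powr_realpow)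
  next
    case 3
    have H: "2 powr (- real ?n * Hbar x) = x powr (real ?n * x) * (1 - x) powr (real ?n * (1 - x))"
    proof -
      have e: "- real ?n * Hbar x = log 2 x * (real ?n * x) + log 2 (1 - x) * (real ?n * (1 - x))"
        using 3 by (simp add: Hbar_def algebra_simps)
      show ?thesis unfolding e powr_add powr_powr[symmetric] using 3 by simp
    qed
    have term_le: "x powr (real ?n * x) * (1 - x) powr (real ?n * (1 - x)) \<le> x ^ card S * (1 - x) ^ card (A - S)"
      if S: "S \<in> ?X" for S
    proof -
      have finS: "finite S" and cS: "card S \<le> ?n"
        using S assms(1) by (auto dest: finite_subset intro: card_mono)
      have cd: "real (card (A - S)) = real ?n - real (card S)"
        using S finS cS by (simp add: card_Diff_subset of_nat_diff)
      \<comment> \<open>How far \<open>S\<close> lies inside the ball. Trading \<open>d\<close>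
        factors \<open>1 - x\<close> for \<open>d\<close> factors \<open>x\<close> cannot increase
        the weight, because \<open>x / (1 - x) \<le> 1\<close>.\<close>
      define d where "d = real ?n * x - real (card S)"
      have d: "d \<ge> 0" using S by (simp add: d_def)
      have "x powr (real ?n * x) * (1 - x) powr (real ?n * (1 - x))
          = x powr real (card S) * (1 - x) powr real (card (A - S)) * (x powr d * (1 - x) powr (- d))"
      proof -
        have "real ?n * x = real (card S) + d" by (simp add: d_def)
        moreover have "real ?n * (1 - x) = real (card (A - S)) + (- d)"
          unfolding cd by (simp add: d_def algebra_simps)
        ultimately show ?thesis by (simp only: powr_add mult_ac)
      qed
      also have "x powr d * (1 - x) powr (- d) = (x / (1 - x)) powr d"
        using 3 by (simp add: powr_divide powr_minus_divide)
      also have "\<dots> \<le> 1" using 3 d by (intro powr_le1) auto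
      finally show ?thesis using 3 by (simp add: powr_realpow mult_left_mono)
    qed
    have "real (card ?X) * 2 powr (- real ?n * Hbar x)
        = (\<Sum>S\<in>?X. x powr (real ?n * x) * (1 - x) powr (real ?n * (1 - x)))"
      unfolding H by simp
    also have "\<dots> \<le> (\<Sum>S\<in>?X. x ^ card S * (1 - x) ^ card (A - S))"
      by (intro sum_mono term_le)
    also have "\<dots> \<le> (\<Sum>S\<in>Pow A. x ^ card S * (1 - x) ^ card (A - S))"
      using 3 assms(1) by (intro sum_mono2) auto
    also have "\<dots> = (\<Prod>i\<in>A. x + (1 - x))"
      using assms(1) by (subst prod_add) auto
    also have "\<dots> = 1" by simp
    finally show ?thesis by (simp add: powr_minus divide_simps split: if_splits)
  qed
qed

subsection \<open>Spectral theorem and trace norm\<close>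

lemma mat_adjoint_eq_mat:
  fixes A :: "complex mat"
  shows "mat_adjoint A = mat (dim_col A) (dim_row A) (\<lambda>(i, j). cnj (A $$ (j, i)))"
  by (rule eq_matI) (auto simp: mat_adjoint_def mat_of_rows_def)

lemma mat_adjoint_carrier:
  fixes A :: "complex mat"
  assumes "A \<in> carrier_mat n m"
  shows "mat_adjoint A \<in> carrier_mat m n"
  using assms by (simp add: mat_adjoint_eq_mat)

lemma mat_adjoint_mult:
  fixes A B :: "complex mat"
  assumes "A \<in> carrier_mat n m" "B \<in> carrier_mat m k"
  shows "mat_adjoint (A * B) = mat_adjoint B * mat_adjoint A"
  using assms by (intro eq_matI) (auto simp: mat_adjoint_eq_mat scalar_prod_def mult.commute)

lemma mat_adjoint_adjoint:
  fixes A :: "complex mat"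
  shows "mat_adjoint (mat_adjoint A) = A"
  by (intro eq_matI) (auto simp: mat_adjoint_eq_mat)

text \<open>Complete \<open>v\<close> to a basis and orthogonalise it: Gram-Schmidt leaves the first
  vector alone, and normalising the columns only rescales it, hence the scalar
  \<open>c\<close>.\<close>

lemma unitary_first_column_exists:
  fixes v :: "complex vec"
  assumes v: "v \<in> carrier_vec n" "v \<noteq> 0\<^sub>v n"
  shows "\<exists>W \<in> carrier_mat n n. mat_adjoint W * W = 1\<^sub>m n \<and> (\<exists>c. col W 0 = c \<cdot>\<^sub>v v)"
proof -
  interpret cof_vec_space n "TYPE(complex)" .
  have n: "n \<noteq> 0" using v by auto
  define b where "b = basis_completion v"
  define ws where "ws = gram_schmidt n b"
  from basis_completion[OF v, folded b_def]
  have dist_b: "distinct b" and indep: "\<not> lin_dep (set b)" and b: "set b \<subseteq> carrier_vec n"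
    and hdb: "hd b = v" and len_b: "length b = n" by auto
  from hdb len_b n obtain vs where bv: "b = v # vs" by (cases b) auto
  from gram_schmidt_result[OF b dist_b indep refl, folded ws_def]
  have ws: "set ws \<subseteq> carrier_vec n" "corthogonal ws" "length ws = n" by (auto simp: len_b)
  have ws0: "ws ! 0 = v"
    using gram_schmidt_hd[OF v(1), of vs, folded bv] ws(3) n unfolding ws_def by (cases "gram_schmidt n b") auto
  define s where "s k = complex_of_real (sqrt (\<Sum>i<n. (cmod (ws ! k $ i))\<^sup>2))" for k
  define W where "W = mat n n (\<lambda>(i, k). ws ! k $ i / s k)"
  have W: "W \<in> carrier_mat n n" by (simp add: W_def)
  have dimw: "dim_vec (ws ! k) = n" if "k < n" for k
    using ws that by (metis carrier_vecD nth_mem subsetD)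
  have ip: "ws ! k \<bullet>c ws ! l = (\<Sum>i<n. ws ! k $ i * cnj (ws ! l $ i))" if "k < n" "l < n" for k l
    using that dimw by (auto simp: scalar_prod_def lessThan_atLeast0 intro!: sum.cong)
  have ss: "s k * s k = ws ! k \<bullet>c ws ! k" if "k < n" for k
  proof -
    have "s k * s k = complex_of_real (\<Sum>i<n. (cmod (ws ! k $ i))\<^sup>2)"
      unfolding s_def of_real_mult[symmetric] by (simp add: sum_nonneg)
    also have "\<dots> = (\<Sum>i<n. ws ! k $ i * cnj (ws ! k $ i))"
      by (simp only: of_real_sum complex_norm_square)
    finally show ?thesis using ip that by simp
  qed
  have "mat_adjoint W * W = 1\<^sub>m n"
  proof (rule eq_matI)
    fix k l assume "k < dim_row (1\<^sub>m n)" "l < dim_col (1\<^sub>m n)"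
    then have kl: "k < n" "l < n" by auto
    have cs: "cnj (s k) = s k" by (simp add: s_def)
    have "(mat_adjoint W * W) $$ (k, l) = (\<Sum>i<n. cnj (ws ! k $ i / s k) * (ws ! l $ i / s l))"
      using kl by (simp add: mat_adjoint_eq_mat W_def scalar_prod_def lessThan_atLeast0)
    also have "\<dots> = (\<Sum>i<n. ws ! l $ i * cnj (ws ! k $ i)) / (s k * s l)"
      by (simp add: cs sum_divide_distrib mult.commute)
    also have "\<dots> = (ws ! l \<bullet>c ws ! k) / (s k * s l)"
      using ip kl by simp
    also have "\<dots> = (if k = l then 1 else 0)"
      using ss[OF kl(1)] corthogonalD[OF ws(2), of l k] kl ws(3) by auto
    finally show "(mat_adjoint W * W) $$ (k, l) = 1\<^sub>m n $$ (k, l)" using kl by simp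
  qed (auto simp: mat_adjoint_eq_mat W_def)
  moreover have "col W 0 = (1 / s 0) \<cdot>\<^sub>v v"
    using n v by (intro eq_vecI) (auto simp: W_def ws0)
  ultimately show ?thesis using W by blast
qed

text \<open>Deflation: a unitary \<open>W\<close> whose first column is an eigenvector of
  \<open>A\<close> turns \<open>A\<close> into a block matrix with the eigenvalue in the corner, and
  the induction hypothesis diagonalises the remaining block.\<close>

lemma hermitian_diagonalization:
  fixes A :: "complex mat"
  assumes "A \<in> carrier_mat n n" "mat_adjoint A = A"
  shows "\<exists>U \<in> carrier_mat n n. \<exists>D \<in> carrier_mat n n.
    mat_adjoint U * U = 1\<^sub>m n \<and> diagonal_mat D \<and> mat_adjoint U * A * U = D"
  using assms
proof (induction n arbitrary: A)
  case 0
  then show ?case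
    by (intro bexI[of _ "1\<^sub>m 0"]) (auto simp: diagonal_mat_def mat_adjoint_eq_mat intro!: eq_matI)
next
  case (Suc n)
  note A = Suc.prems(1)
  have "degree (char_poly A) = Suc n" using degree_monic_char_poly[OF A] by simp
  then have "\<not> constant (poly (char_poly A))" by (simp add: constant_degree)
  then obtain e where "poly (char_poly A) e = 0" using fundamental_theorem_of_algebra by blast
  then have "eigenvalue A e" using eigenvalue_root_char_poly[OF A] by simp
  then obtain v where v: "v \<in> carrier_vec (Suc n)" "v \<noteq> 0\<^sub>v (Suc n)" "A *\<^sub>v v = e \<cdot>\<^sub>v v"
    using A unfolding eigenvalue_def eigenvector_def by auto
  obtain W c where W: "W \<in> carrier_mat (Suc n) (Suc n)" "mat_adjoint W * W = 1\<^sub>m (Suc n)"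
    and Wc: "col W 0 = c \<cdot>\<^sub>v v"
    using unitary_first_column_exists[OF v(1,2)] by blast
  note W' = mat_adjoint_carrier[OF W(1)]
  define B where "B = mat_adjoint W * A * W"
  have B: "B \<in> carrier_mat (Suc n) (Suc n)" using W W' A by (simp add: B_def)
  have Bh: "mat_adjoint B = B"
  proof -
    have "mat_adjoint B = mat_adjoint W * mat_adjoint (mat_adjoint W * A)"
      unfolding B_def using W' A W by (intro mat_adjoint_mult[of _ "Suc n" "Suc n" _ "Suc n"]) auto
    also have "mat_adjoint (mat_adjoint W * A) = A * W"
      using mat_adjoint_mult[OF W' A] by (simp add: mat_adjoint_adjoint Suc.prems)
    also have "mat_adjoint W * (A * W) = B"
      unfolding B_def using W' A W(1) by (intro assoc_mult_mat[symmetric])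
    finally show ?thesis .
  qed
  have "A *\<^sub>v (c \<cdot>\<^sub>v v) = e \<cdot>\<^sub>v (c \<cdot>\<^sub>v v)"
    using v A by (simp add: mult_mat_vec smult_smult_assoc mult.commute)
  then have Ac: "A *\<^sub>v col W 0 = e \<cdot>\<^sub>v col W 0" by (simp add: Wc)
  have cW: "col W 0 \<in> carrier_vec (Suc n)" using carrier_matD[OF W(1)] by (simp add: carrier_vecI)
  have "col B 0 = mat_adjoint W * A *\<^sub>v col W 0"
    unfolding B_def using W W' A by (intro col_mult2) auto
  also have "\<dots> = mat_adjoint W *\<^sub>v (e \<cdot>\<^sub>v col W 0)"
    using assoc_mult_mat_vec[OF W' A cW] Ac by simp
  also have "\<dots> = e \<cdot>\<^sub>v (mat_adjoint W *\<^sub>v col W 0)"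
    using mult_mat_vec[OF W' cW] .
  also have "mat_adjoint W *\<^sub>v col W 0 = col (mat_adjoint W * W) 0"
    using W W' by (intro col_mult2[symmetric]) auto
  also have "\<dots> = unit_vec (Suc n) 0" unfolding W(2) by simp
  finally have colB: "col B 0 = e \<cdot>\<^sub>v unit_vec (Suc n) 0" .
  have B0: "B $$ (i, 0) = (if i = 0 then e else 0)" if "i < Suc n" for i
    using arg_cong[OF colB, of "\<lambda>v. v $ i"] that B by auto
  \<comment> \<open>The first column vanishes below the corner because of the eigenvector; the first
    row vanishes because conjugation by \<open>W\<close> keeps the matrix Hermitian.\<close>
  have B0': "B $$ (0, i) = 0" if "i < Suc n" "i \<noteq> 0" for i
  proof -
    have "B $$ (0, i) = mat_adjoint B $$ (0, i)" by (simp add: Bh)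
    also have "\<dots> = cnj (B $$ (i, 0))" using B that by (simp add: mat_adjoint_eq_mat)
    finally show ?thesis using B0 that by simp
  qed
  define C where "C = mat n n (\<lambda>(i, j). B $$ (Suc i, Suc j))"
  have C: "C \<in> carrier_mat n n" by (simp add: C_def)
  have Ch: "mat_adjoint C = C"
  proof (rule eq_matI)
    fix i j assume "i < dim_row C" "j < dim_col C"
    then have ij: "i < n" "j < n" by (auto simp: C_def)
    have "B $$ (Suc i, Suc j) = mat_adjoint B $$ (Suc i, Suc j)" by (simp add: Bh)
    also have "\<dots> = cnj (B $$ (Suc j, Suc i))" using B ij by (simp add: mat_adjoint_eq_mat)
    finally show "mat_adjoint C $$ (i, j) = C $$ (i, j)"
      using ij by (simp add: mat_adjoint_eq_mat C_def)
  qed (auto simp: mat_adjoint_eq_mat C_def)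
  define E where "E = mat 1 1 (\<lambda>_. e)"
  have E: "E \<in> carrier_mat 1 1" by (simp add: E_def)
  have Bblock: "B = four_block_mat E (0\<^sub>m 1 n) (0\<^sub>m n 1) C"
  proof (rule eq_matI)
    fix i j assume "i < dim_row (four_block_mat E (0\<^sub>m 1 n) (0\<^sub>m n 1) C)"
      "j < dim_col (four_block_mat E (0\<^sub>m 1 n) (0\<^sub>m n 1) C)"
    then have ij: "i < Suc n" "j < Suc n" by (auto simp: E_def C_def)
    then show "B $$ (i, j) = four_block_mat E (0\<^sub>m 1 n) (0\<^sub>m n 1) C $$ (i, j)"
      using B0 B0' by (cases i; cases j) (auto simp: E_def C_def)
  qed (use B in \<open>auto simp: E_def C_def\<close>)
  from Suc.IH[OF C Ch] obtain V D where V: "V \<in> carrier_mat n n" and D: "D \<in> carrier_mat n n"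
    and VV: "mat_adjoint V * V = 1\<^sub>m n" and dD: "diagonal_mat D" and VCV: "mat_adjoint V * C * V = D"
    by blast
  note V' = mat_adjoint_carrier[OF V]
  define F where "F = four_block_mat (1\<^sub>m 1) (0\<^sub>m 1 n) (0\<^sub>m n 1) V"
  define G where "G = four_block_mat E (0\<^sub>m 1 n) (0\<^sub>m n 1) D"
  have F: "F \<in> carrier_mat (Suc n) (Suc n)" using V by (auto simp: F_def)
  have F'_eq: "mat_adjoint F = four_block_mat (1\<^sub>m 1) (0\<^sub>m 1 n) (0\<^sub>m n 1) (mat_adjoint V)"
    using V V' by (intro eq_matI) (auto simp: F_def mat_adjoint_eq_mat)
  note F' = mat_adjoint_carrier[OF F]
  have FF: "mat_adjoint F * F = 1\<^sub>m (Suc n)"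
  proof -
    have "mat_adjoint F * F = four_block_mat (1\<^sub>m 1) (0\<^sub>m 1 n) (0\<^sub>m n 1) (1\<^sub>m n)"
      unfolding F'_eq unfolding F_def using V V'
      by (subst mult_four_block_mat[of _ 1 1 _ n _ n _ _ 1 _ n]) (auto simp: VV)
    also have "\<dots> = 1\<^sub>m (Suc n)" by (intro eq_matI) auto
    finally show ?thesis .
  qed
  have FBF: "mat_adjoint F * B * F = G"
  proof -
    have "mat_adjoint F * B = four_block_mat E (0\<^sub>m 1 n) (0\<^sub>m n 1) (mat_adjoint V * C)"
      unfolding F'_eq Bblock using V V' E C
      by (subst mult_four_block_mat[of _ 1 1 _ n _ n _ _ 1 _ n]) auto
    moreover have "\<dots> * F = G"
      unfolding F_def G_def using V V' E C D
      by (subst mult_four_block_mat[of _ 1 1 _ n _ n _ _ 1 _ n]) (auto simp: VCV)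
    ultimately show ?thesis by simp
  qed
  define U where "U = W * F"
  have U: "U \<in> carrier_mat (Suc n) (Suc n)" using W F by (simp add: U_def)
  have U': "mat_adjoint U = mat_adjoint F * mat_adjoint W"
    unfolding U_def using mat_adjoint_mult[OF W(1) F] .
  have G: "G \<in> carrier_mat (Suc n) (Suc n)" using E D by (auto simp: G_def)
  have "mat_adjoint U * U = mat_adjoint F * (mat_adjoint W * (W * F))"
    unfolding U' unfolding U_def using F' W' W F by (intro assoc_mult_mat) auto
  also have "mat_adjoint W * (W * F) = F"
    using assoc_mult_mat[OF W' W(1) F] W F by simp
  finally have UU: "mat_adjoint U * U = 1\<^sub>m (Suc n)" using FF by simp
  have "mat_adjoint U * A * U = mat_adjoint F * (mat_adjoint W * A) * (W * F)"
    unfolding U' unfolding U_def using assoc_mult_mat[OF F' W' A] by simp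
  also have "\<dots> = mat_adjoint F * (mat_adjoint W * A * (W * F))"
    using F' W' A W F by (intro assoc_mult_mat) auto
  also have "mat_adjoint W * A * (W * F) = B * F"
    unfolding B_def using W' A W F by (intro assoc_mult_mat[symmetric]) auto
  also have "mat_adjoint F * (B * F) = G"
    using assoc_mult_mat[OF F' B F] FBF by simp
  finally have UAU: "mat_adjoint U * A * U = G" .
  have "diagonal_mat G"
    using dD D E unfolding G_def diagonal_mat_def by auto
  with U G UU UAU show ?case by blast
qed

text \<open>Translates the sum over distinct roots in \<open>trace_norm\<close> into a sum over a
  list of linear factors in which repeated roots are repeated entries.\<close>

lemma sum_roots_with_multiplicity:
  fixes f :: "complex \<Rightarrow> real"
  defines "P as \<equiv> (\<Prod>a\<leftarrow>as. [:- a, 1:])"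
  shows "(\<Sum>z\<in>{z. poly (P as) z = 0}. real (order z (P as)) * f z) = (\<Sum>a\<leftarrow>as. f a)"
proof -
  have nz: "P as \<noteq> 0" for as by (auto simp: P_def prod_list_zero_iff simp del: prod_list.Cons)
  \<comment> \<open>The root set changes with the list, so the induction runs over a fixed finite
    superset \<open>S\<close>; points that are not roots have order 0 and contribute
    nothing.\<close>
  have "(\<Sum>z\<in>S. real (order z (P as)) * f z) = (\<Sum>a\<leftarrow>as. f a)" if "finite S" "set as \<subseteq> S" for S
    using that
  proof (induction as)
    case Nil
    have "order z (1 :: complex poly) = 0" for z by (simp add: order_root order_0I)
    then show ?case by (simp add: P_def)
  next
    case (Cons a as)
    have "order z (P (a # as)) = (if z = a then 1 else 0) + order z (P as)" for z
    proof -
      have eq: "P (a # as) = [:- a, 1:] * P as" by (simp only: P_def list.map prod_list.Cons)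
      show ?thesis using nz[of "a # as"] unfolding eq by (subst order_mult) (auto simp: order_linear')
    qed
    then have "(\<Sum>z\<in>S. real (order z (P (a # as))) * f z)
        = (\<Sum>z\<in>S. (if z = a then f z else 0) + real (order z (P as)) * f z)"
      by (intro sum.cong) (auto simp: algebra_simps)
    also have "\<dots> = f a + (\<Sum>z\<in>S. real (order z (P as)) * f z)"
      using Cons.prems by (simp add: sum.distrib)
    finally show ?case using Cons by simp
  qed
  moreover have "{z. poly (P as) z = 0} = set as"
    by (auto simp: P_def poly_prod_list prod_list_zero_iff)
  ultimately show ?thesis by simp
qed

text \<open>Diagonalising \<open>X\<close> by a unitary makes \<open>mat_adjoint X * X\<close>
  similar to the diagonal matrix of the squared moduli of the eigenvalues of \<open>X\<close>.
  Similar matrices share their characteristic polynomial, so the singular values are these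
  moduli.\<close>

lemma trace_norm_hermitian_eq:
  fixes X :: "complex mat"
  assumes X: "X \<in> carrier_mat d d" "mat_adjoint X = X"
  shows "\<exists>U \<in> carrier_mat d d. mat_adjoint U * U = 1\<^sub>m d \<and>
    trace_norm X = (\<Sum>k<d. cmod ((mat_adjoint U * X * U) $$ (k, k)))"
proof -
  obtain U D where U: "U \<in> carrier_mat d d" and D: "D \<in> carrier_mat d d"
    and UU: "mat_adjoint U * U = 1\<^sub>m d" and dD: "diagonal_mat D" and UXU: "mat_adjoint U * X * U = D"
    using hermitian_diagonalization[OF X] by blast
  note U' = mat_adjoint_carrier[OF U] and D' = mat_adjoint_carrier[OF D]
  have UU': "U * mat_adjoint U = 1\<^sub>m d" by (rule mat_mult_left_right_inverse[OF U' U UU])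
  have XU: "X * U = U * D"
  proof -
    have "U * D = U * (mat_adjoint U * (X * U))"
      using UXU assoc_mult_mat[OF U' X(1) U] by simp
    also have "\<dots> = U * mat_adjoint U * (X * U)"
      using U U' X by (intro assoc_mult_mat[symmetric]) auto
    finally show ?thesis using UU' X U by simp
  qed
  have UX: "mat_adjoint U * X = mat_adjoint D * mat_adjoint U"
    using mat_adjoint_mult[OF X(1) U] mat_adjoint_mult[OF U D] X XU by simp
  have XX: "mat_adjoint X * X = U * (mat_adjoint D * D) * mat_adjoint U"
  proof -
    have "U * (mat_adjoint D * D) * mat_adjoint U = U * (mat_adjoint D * (D * mat_adjoint U))"
      using U D D' U' by (simp add: assoc_mult_mat[of _ d d _ d _ d])
    also have "D * mat_adjoint U = mat_adjoint U * (X * U) * mat_adjoint U"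
      using UXU assoc_mult_mat[OF U' X(1) U] by simp
    also have "\<dots> = mat_adjoint U * X * (U * mat_adjoint U)"
      using U U' X by (simp add: assoc_mult_mat[of _ d d _ d _ d])
    also have "\<dots> = mat_adjoint U * X" using UU' U' X by simp
    also have "U * (mat_adjoint D * (mat_adjoint U * X)) = U * ((mat_adjoint D * mat_adjoint U) * X)"
      using U U' X D' by (simp add: assoc_mult_mat[of _ d d _ d _ d])
    also have "\<dots> = U * mat_adjoint U * X * X"
      unfolding UX[symmetric] using U U' X by (simp add: assoc_mult_mat[of _ d d _ d _ d])
    finally show ?thesis using UU' X by simp
  qed
  have DD: "mat_adjoint D * D \<in> carrier_mat d d" using D D' by simp
  have "similar_mat_wit (mat_adjoint X * X) (mat_adjoint D * D) U (mat_adjoint U)"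
    using X U U' UU UU' XX DD by (intro similar_mat_witI[of _ _ d]) (auto simp: X)
  then have "char_poly (mat_adjoint X * X) = char_poly (mat_adjoint D * D)"
    by (intro char_poly_similar) (auto simp: similar_mat_def)
  have DD_entry: "(mat_adjoint D * D) $$ (i, j) = (if i = j then cnj (D $$ (i, i)) * D $$ (i, i) else 0)"
    if "i < d" "j < d" for i j
  proof -
    have "(mat_adjoint D * D) $$ (i, j) = (\<Sum>k<d. cnj (D $$ (k, i)) * D $$ (k, j))"
      using D that by (simp add: mat_adjoint_eq_mat scalar_prod_def lessThan_atLeast0)
    also have "\<dots> = (\<Sum>k<d. if k = i then (if i = j then cnj (D $$ (i, i)) * D $$ (i, i) else 0) else 0)"
      using dD D that by (intro sum.cong) (auto simp: diagonal_mat_def)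
    finally show ?thesis using that by simp
  qed
  have ut: "upper_triangular (mat_adjoint D * D)"
    using DD DD_entry by (auto simp: upper_triangular_def)
  define as where "as = map (\<lambda>i. cnj (D $$ (i, i)) * D $$ (i, i)) [0..<d]"
  have "diag_mat (mat_adjoint D * D) = as"
    using DD DD_entry by (auto simp: diag_mat_def as_def)
  then have cp: "char_poly (mat_adjoint X * X) = (\<Prod>a\<leftarrow>as. [:- a, 1:])"
    using char_poly_upper_triangular[OF DD ut] \<open>char_poly (mat_adjoint X * X) = _\<close> by simp
  have "trace_norm X = (\<Sum>a\<leftarrow>as. sqrt (cmod a))"
    unfolding trace_norm_def Let_def cp by (rule sum_roots_with_multiplicity)
  also have "\<dots> = (\<Sum>k<d. cmod (D $$ (k, k)))"
    by (simp add: as_def o_def norm_mult real_sqrt_mult interv_sum_list_conv_sum_set_nat lessThan_atLeast0)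
  finally show ?thesis using U UU UXU by blast
qed

subsection \<open>Positive forms and compressions\<close>

text \<open>Vectors are functions of which only the components below \<open>d\<close> count, as in
  \<open>density_op\<close> and \<open>outcome_prob\<close>, so that both unfold to this form
  directly. The form is conjugate linear in \<open>u\<close>.\<close>

definition qform :: "nat \<Rightarrow> complex mat \<Rightarrow> (nat \<Rightarrow> complex) \<Rightarrow> (nat \<Rightarrow> complex) \<Rightarrow> complex" where
  "qform d R u v = (\<Sum>i<d. \<Sum>j<d. cnj (u i) * R $$ (i, j) * v j)"

definition psd :: "nat \<Rightarrow> complex mat \<Rightarrow> bool" where
  "psd d R \<longleftrightarrow> (\<forall>v. Im (qform d R v v) = 0 \<and> 0 \<le> Re (qform d R v v))"

definition onb :: "nat \<Rightarrow> (nat \<Rightarrow> nat \<Rightarrow> complex) \<Rightarrow> bool" where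
  "onb d b \<longleftrightarrow> (\<forall>k<d. \<forall>l<d. (\<Sum>i<d. cnj (b k i) * b l i) = (if k = l then 1 else 0))"

lemma density_op_iff_psd:
  "density_op k \<rho> \<longleftrightarrow> \<rho> \<in> carrier_mat (2 ^ k) (2 ^ k) \<and> psd (2 ^ k) \<rho> \<and> mtrace \<rho> = 1"
  by (simp add: density_op_def psd_def qform_def Let_def)

lemma psd_qform_nonneg: "psd d R \<Longrightarrow> 0 \<le> Re (qform d R v v)"
  and psd_qform_real: "psd d R \<Longrightarrow> Im (qform d R v v) = 0"
  by (auto simp: psd_def)

lemma qform_cong:
  assumes "\<And>i. i < d \<Longrightarrow> u i = u' i" "\<And>i. i < d \<Longrightarrow> v i = v' i"
  shows "qform d R u v = qform d R u' v'"
  unfolding qform_def using assms by (intro sum.cong) auto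

lemma qform_add_left: "qform d R (\<lambda>i. u i + u' i) v = qform d R u v + qform d R u' v"
  and qform_add_right: "qform d R u (\<lambda>i. v i + v' i) = qform d R u v + qform d R u v'"
  by (simp_all add: qform_def sum.distrib algebra_simps)

lemma qform_scale_left: "qform d R (\<lambda>i. c * u i) v = cnj c * qform d R u v"
  and qform_scale_right: "qform d R u (\<lambda>i. c * v i) = c * qform d R u v"
  by (simp_all add: qform_def sum_distrib_left mult_ac)

lemma qform_diff_left: "qform d R (\<lambda>i. u i - u' i) v = qform d R u v - qform d R u' v"
  and qform_diff_right: "qform d R u (\<lambda>i. v i - v' i) = qform d R u v - qform d R u v'"
  by (simp_all add: qform_def sum_subtractf algebra_simps)

lemma qform_zero_left: "qform d R (\<lambda>i. 0) v = 0"
  and qform_zero_right: "qform d R u (\<lambda>i. 0) = 0"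
  by (simp_all add: qform_def)

lemma qform_sum_left: "qform d R (\<lambda>i. \<Sum>k\<in>S. f k i) v = (\<Sum>k\<in>S. qform d R (f k) v)"
  by (induction S rule: infinite_finite_induct) (simp_all add: qform_zero_left qform_add_left)

lemma qform_sum_right: "qform d R u (\<lambda>i. \<Sum>k\<in>S. f k i) = (\<Sum>k\<in>S. qform d R u (f k))"
  by (induction S rule: infinite_finite_induct) (simp_all add: qform_zero_right qform_add_right)

lemma qform_smult_mat:
  assumes "R \<in> carrier_mat d d"
  shows "qform d (c \<cdot>\<^sub>m R) u v = c * qform d R u v"
  using assms by (simp add: qform_def sum_distrib_left mult_ac)

lemma qform_minus_mat:
  assumes "R \<in> carrier_mat d d" "S \<in> carrier_mat d d"
  shows "qform d (R - S) u v = qform d R u v - qform d S u v"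
  using assms by (simp add: qform_def sum_subtractf algebra_simps)

text \<open>A left inverse of a square matrix is also a right inverse: orthonormal columns give the
  resolution of the identity.\<close>

lemma onb_complete:
  assumes b: "onb d b" and ij: "i < d" "j < d"
  shows "(\<Sum>k<d. b k i * cnj (b k j)) = (if i = j then 1 else 0)"
proof -
  define U where "U = mat d d (\<lambda>(i, k). b k i)"
  define U' where "U' = mat d d (\<lambda>(k, i). cnj (b k i))"
  have c: "U \<in> carrier_mat d d" "U' \<in> carrier_mat d d" by (auto simp: U_def U'_def)
  have "U' * U = 1\<^sub>m d"
    using b by (intro eq_matI) (auto simp: U_def U'_def scalar_prod_def onb_def lessThan_atLeast0)
  then have "U * U' = 1\<^sub>m d" by (rule mat_mult_left_right_inverse[OF c(2,1)])
  then have "(U * U') $$ (i, j) = (if i = j then 1 else 0)" using ij by simp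
  then show ?thesis using ij by (simp add: U_def U'_def scalar_prod_def lessThan_atLeast0)
qed

text \<open>Basis independence of the trace, from the resolution of the identity.\<close>

lemma sum_qform_onb:
  assumes b: "onb d b" and R: "R \<in> carrier_mat d d"
  shows "(\<Sum>k<d. qform d R (b k) (b k)) = mtrace R"
proof -
  have "(\<Sum>k<d. qform d R (b k) (b k)) = (\<Sum>i<d. \<Sum>j<d. R $$ (i, j) * (\<Sum>k<d. b k j * cnj (b k i)))"
  proof -
    have "(\<Sum>k<d. qform d R (b k) (b k)) = (\<Sum>i<d. \<Sum>k<d. \<Sum>j<d. cnj (b k i) * R $$ (i, j) * b k j)"
      unfolding qform_def by (rule sum.swap)
    also have "\<dots> = (\<Sum>i<d. \<Sum>j<d. \<Sum>k<d. cnj (b k i) * R $$ (i, j) * b k j)"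
      by (rule sum.cong[OF refl]) (rule sum.swap)
    finally show ?thesis by (simp add: sum_distrib_left mult_ac)
  qed
  also have "\<dots> = (\<Sum>i<d. \<Sum>j<d. if j = i then R $$ (i, i) else 0)"
    by (intro sum.cong) (auto simp: onb_complete[OF b])
  finally show ?thesis using R by (simp add: mtrace_def)
qed

text \<open>Polarisation: the form is real at \<open>e i + e j\<close> and at
  \<open>e i + \<i> * e j\<close>, which relates the imaginary and the real parts of the entries
  \<open>(i, j)\<close> and \<open>(j, i)\<close>.\<close>

lemma psd_hermitian:
  assumes R: "R \<in> carrier_mat d d" "psd d R"
  shows "mat_adjoint R = R"
proof (rule eq_matI)
  fix i j assume "i < dim_row R" "j < dim_col R"
  then have ij: "i < d" "j < d" using R by auto
  define e :: "nat \<Rightarrow> nat \<Rightarrow> complex" where "e k l = (if l = k then 1 else 0)" for k l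
  have entry: "qform d R (e k) (e l) = R $$ (k, l)" if "k < d" "l < d" for k l
  proof -
    have "qform d R (e k) (e l) = (\<Sum>i<d. \<Sum>j<d. if j = l then (if i = k then R $$ (k, l) else 0) else 0)"
      unfolding qform_def e_def by (intro sum.cong) auto
    then show ?thesis using that by simp
  qed
  have re: "Im (qform d R v v) = 0" for v using R by (simp add: psd_def)
  have a: "Im (R $$ (i, j)) + Im (R $$ (j, i)) = 0"
    using re[of "\<lambda>l. e i l + e j l"] re[of "e i"] re[of "e j"]
    by (simp add: qform_add_left qform_add_right entry ij)
  have b: "Re (R $$ (i, j)) - Re (R $$ (j, i)) = 0"
    using re[of "\<lambda>l. e i l + \<i> * e j l"] re[of "e i"] re[of "e j"]
    by (simp add: qform_add_left qform_add_right qform_scale_left qform_scale_right entry ij)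
  show "mat_adjoint R $$ (i, j) = R $$ (i, j)"
    using a b ij R by (simp add: mat_adjoint_eq_mat complex_eq_iff)
qed (use R in \<open>auto simp: mat_adjoint_eq_mat\<close>)

text \<open>Presents the eigenbasis of \<open>X\<close> as an \<open>onb\<close>, so that trace
  norms can be estimated through quadratic forms alone.\<close>

lemma trace_norm_hermitian_qform:
  assumes X: "X \<in> carrier_mat d d" "mat_adjoint X = X"
  shows "\<exists>u. onb d u \<and> trace_norm X = (\<Sum>k<d. cmod (qform d X (u k) (u k)))"
proof -
  obtain U where U: "U \<in> carrier_mat d d" "mat_adjoint U * U = 1\<^sub>m d"
    and tn: "trace_norm X = (\<Sum>k<d. cmod ((mat_adjoint U * X * U) $$ (k, k)))"
    using trace_norm_hermitian_eq[OF X] by blast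
  define u where "u k i = U $$ (i, k)" for k i
  have "onb d u"
    unfolding onb_def
  proof (intro allI impI)
    fix k l assume kl: "k < d" "l < d"
    have "(\<Sum>i<d. cnj (u k i) * u l i) = (mat_adjoint U * U) $$ (k, l)"
      using U(1) kl by (simp add: mat_adjoint_eq_mat u_def scalar_prod_def lessThan_atLeast0)
    then show "(\<Sum>i<d. cnj (u k i) * u l i) = (if k = l then 1 else 0)" using U(2) kl by simp
  qed
  moreover have "(mat_adjoint U * X * U) $$ (k, k) = qform d X (u k) (u k)" if k: "k < d" for k
  proof -
    have "(mat_adjoint U * X * U) $$ (k, k) = (\<Sum>j<d. (\<Sum>i<d. cnj (U $$ (i, k)) * X $$ (i, j)) * U $$ (j, k))"
      using U(1) X(1) k by (simp add: mat_adjoint_eq_mat scalar_prod_def lessThan_atLeast0)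
    also have "\<dots> = qform d X (u k) (u k)"
      unfolding qform_def u_def sum_distrib_right by (rule sum.swap)
    finally show ?thesis .
  qed
  ultimately show ?thesis using tn by (intro exI[of _ u]) simp
qed

text \<open>Jensen for a positive form, from \<open>card J * \<Sum> f (x k) - f (\<Sum> x k) = 1/2 * \<Sum>\<Sum> f (x k - x l)\<close>.\<close>
lemma psd_qform_sum_le:
  assumes R: "psd d R" and J: "finite J"
  shows "Re (qform d R (\<lambda>i. \<Sum>k\<in>J. x k i) (\<lambda>i. \<Sum>k\<in>J. x k i))
       \<le> real (card J) * (\<Sum>k\<in>J. Re (qform d R (x k) (x k)))"
proof -
  define B where "B k l = Re (qform d R (x k) (x l))" for k l
  have "0 \<le> (\<Sum>k\<in>J. \<Sum>l\<in>J. Re (qform d R (\<lambda>i. x k i - x l i) (\<lambda>i. x k i - x l i)))"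
    by (intro sum_nonneg psd_qform_nonneg R)
  also have "\<dots> = (\<Sum>k\<in>J. \<Sum>l\<in>J. B k k + B l l - B k l - B l k)"
    by (simp add: B_def qform_diff_left qform_diff_right algebra_simps)
  also have "\<dots> = 2 * (real (card J) * (\<Sum>k\<in>J. B k k)) - 2 * (\<Sum>k\<in>J. \<Sum>l\<in>J. B k l)"
    using sum.swap[of "\<lambda>k l. B l k" J J]
    by (simp add: sum_subtractf sum.distrib sum_distrib_left[symmetric])
  also have "(\<Sum>k\<in>J. \<Sum>l\<in>J. B k l) = Re (qform d R (\<lambda>i. \<Sum>k\<in>J. x k i) (\<lambda>i. \<Sum>k\<in>J. x k i))"
    by (simp add: qform_sum_left qform_sum_right B_def)
  finally show ?thesis by (simp add: B_def)
qed

section \<open>Projections onto part of an orthonormal basis, and compressions\<close>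

definition onb_proj :: "nat \<Rightarrow> (nat \<Rightarrow> nat \<Rightarrow> complex) \<Rightarrow> nat set \<Rightarrow> (nat \<Rightarrow> complex) \<Rightarrow> nat \<Rightarrow> complex" where
  "onb_proj d b J v i = (\<Sum>k\<in>J. (\<Sum>l<d. cnj (b k l) * v l) * b k i)"

text \<open>The matrix of \<open>P R P\<close>, where \<open>P\<close> is the orthogonal projection
  onto the span of the \<open>b k\<close> with \<open>k \<in> J\<close>. The entries are forms at
  projected unit vectors, which avoids a matrix for \<open>P\<close>.\<close>

definition compress :: "nat \<Rightarrow> (nat \<Rightarrow> nat \<Rightarrow> complex) \<Rightarrow> nat set \<Rightarrow> complex mat \<Rightarrow> complex mat" where
  "compress d b J R = mat d d (\<lambda>(i, j). qform d R (onb_proj d b J (\<lambda>l. of_bool (l = i))) (onb_proj d b J (\<lambda>l. of_bool (l = j))))"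

lemma compress_carrier: "compress d b J R \<in> carrier_mat d d"
  by (simp add: compress_def)

lemma onb_proj_expand:
  "onb_proj d b J v l = (\<Sum>i<d. v i * onb_proj d b J (\<lambda>l. of_bool (l = i)) l)"
proof -
  have "(\<Sum>m<d. cnj (b k m) * of_bool (m = i)) = cnj (b k i)" if "i < d" for k i
    using that by (simp add: of_bool_def if_distrib cong: if_cong)
  then have "(\<Sum>i<d. v i * onb_proj d b J (\<lambda>l. of_bool (l = i)) l) = (\<Sum>i<d. v i * (\<Sum>k\<in>J. cnj (b k i) * b k l))"
    unfolding onb_proj_def by (intro sum.cong) auto
  also have "\<dots> = onb_proj d b J v l"
    unfolding onb_proj_def sum_distrib_left sum_distrib_right by (subst sum.swap) (simp add: mult_ac)
  finally show ?thesis ..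
qed

lemma qform_compress:
  "qform d (compress d b J R) u v = qform d R (onb_proj d b J u) (onb_proj d b J v)"
proof -
  let ?p = "\<lambda>i. onb_proj d b J (\<lambda>l. of_bool (l = i))"
  have "qform d R (onb_proj d b J u) (onb_proj d b J v)
      = qform d R (\<lambda>l. \<Sum>i<d. u i * ?p i l) (\<lambda>l. \<Sum>j<d. v j * ?p j l)"
    by (intro qform_cong onb_proj_expand)
  also have "\<dots> = (\<Sum>i<d. \<Sum>j<d. cnj (u i) * (v j * qform d R (?p i) (?p j)))"
    by (simp only: qform_sum_left qform_sum_right qform_scale_left qform_scale_right sum_distrib_left)
  also have "\<dots> = qform d (compress d b J R) u v"
    unfolding qform_def[of d "compress d b J R"] by (simp add: compress_def sum_distrib_left mult_ac)
  finally show ?thesis ..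
qed

lemma psd_compress: "psd d R \<Longrightarrow> psd d (compress d b J R)"
  by (simp add: psd_def qform_compress)

lemma onb_proj_onb:
  assumes "onb d b" "J \<subseteq> {..<d}" "k < d"
  shows "onb_proj d b J (b k) i = (if k \<in> J then b k i else 0)"
proof -
  have "finite J" using assms finite_subset by blast
  have "onb_proj d b J (b k) i = (\<Sum>k'\<in>J. if k' = k then b k i else 0)"
    unfolding onb_proj_def using assms by (intro sum.cong) (auto simp: onb_def)
  then show ?thesis using \<open>finite J\<close> by simp
qed

text \<open>Take the trace in the basis \<open>b\<close> itself, each vector of which is either kept
  or killed by the projection. For a state this is the probability of an outcome in
  \<open>J\<close>.\<close>

lemma mtrace_compress:
  assumes "onb d b" "J \<subseteq> {..<d}"
  shows "mtrace (compress d b J R) = (\<Sum>k\<in>J. qform d R (b k) (b k))"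
proof -
  have "mtrace (compress d b J R) = (\<Sum>k<d. qform d R (onb_proj d b J (b k)) (onb_proj d b J (b k)))"
    using sum_qform_onb[OF assms(1) compress_carrier] by (simp add: qform_compress)
  also have "\<dots> = (\<Sum>k<d. if k \<in> J then qform d R (b k) (b k) else 0)"
    using onb_proj_onb[OF assms] by (intro sum.cong) (auto simp: qform_def)
  also have "\<dots> = (\<Sum>k\<in>J. qform d R (b k) (b k))"
    using assms(2) by (simp add: sum.If_cases Int_absorb1)
  finally show ?thesis .
qed

lemma onb_proj_split:
  assumes "onb d b" "J \<subseteq> {..<d}" "i < d"
  shows "onb_proj d b J v i + onb_proj d b ({..<d} - J) v i = v i"
proof -
  have "onb_proj d b J v i + onb_proj d b ({..<d} - J) v i = (\<Sum>k<d. (\<Sum>l<d. cnj (b k l) * v l) * b k i)"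
    unfolding onb_proj_def using assms(2) by (subst (3) sum.subset_diff[of J]) auto
  also have "\<dots> = (\<Sum>l<d. (\<Sum>k<d. b k i * cnj (b k l)) * v l)"
    unfolding sum_distrib_right by (subst sum.swap) (simp add: mult_ac)
  also have "\<dots> = (\<Sum>l<d. if l = i then v i else 0)"
    using assms by (intro sum.cong) (auto simp: onb_complete)
  finally show ?thesis using assms by simp
qed

text \<open>The projected vector is a sum of \<open>card J\<close> multiples of basis vectors.
  Jensen's inequality costs the factor \<open>card J\<close>, and each coefficient contributes its
  squared modulus, at most \<open>c\<close>. In the application \<open>card J\<close> is the size of
  a Hamming ball and \<open>c\<close> a power of the overlap.\<close>

lemma qform_compress_le:
  assumes R: "psd d R" and J: "J \<subseteq> {..<d}"
    and c: "\<And>k. k \<in> J \<Longrightarrow> (cmod (\<Sum>l<d. cnj (b k l) * v l))\<^sup>2 \<le> c"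
  shows "Re (qform d (compress d b J R) v v) \<le> real (card J) * c * (\<Sum>k\<in>J. Re (qform d R (b k) (b k)))"
proof -
  have fJ: "finite J" using J finite_subset by blast
  let ?a = "\<lambda>k. \<Sum>l<d. cnj (b k l) * v l"
  have "Re (qform d (compress d b J R) v v) \<le> real (card J) * (\<Sum>k\<in>J. Re (qform d R (\<lambda>i. ?a k * b k i) (\<lambda>i. ?a k * b k i)))"
    unfolding qform_compress onb_proj_def by (rule psd_qform_sum_le[OF R fJ])
  also have "(\<Sum>k\<in>J. Re (qform d R (\<lambda>i. ?a k * b k i) (\<lambda>i. ?a k * b k i))) \<le> (\<Sum>k\<in>J. c * Re (qform d R (b k) (b k)))"
  proof (rule sum_mono)
    fix k assume k: "k \<in> J"
    have "qform d R (\<lambda>i. ?a k * b k i) (\<lambda>i. ?a k * b k i) = of_real ((cmod (?a k))\<^sup>2) * qform d R (b k) (b k)"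
      by (simp only: qform_scale_left qform_scale_right complex_norm_square) (simp add: mult_ac)
    then have "Re (qform d R (\<lambda>i. ?a k * b k i) (\<lambda>i. ?a k * b k i)) = (cmod (?a k))\<^sup>2 * Re (qform d R (b k) (b k))"
      by (simp only: Re_complex_of_real Im_complex_of_real times_complex.sel)
    also have "\<dots> \<le> c * Re (qform d R (b k) (b k))"
      using c[OF k] psd_qform_nonneg[OF R] by (intro mult_right_mono) auto
    finally show "Re (qform d R (\<lambda>i. ?a k * b k i) (\<lambda>i. ?a k * b k i)) \<le> c * Re (qform d R (b k) (b k))" .
  qed
  finally show ?thesis by (simp add: sum_distrib_left mult.assoc mult_left_mono)
qed

text \<open>Positivity of the form at \<open>sqrt g * u + v / sqrt g\<close> and at
  \<open>sqrt g * u - v / sqrt g\<close> bounds the cross terms from both sides.\<close>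

lemma psd_cross_le:
  assumes R: "psd d R" and g: "(0::real) < g"
  shows "\<bar>Re (qform d R u v + qform d R v u)\<bar> \<le> g * Re (qform d R u u) + Re (qform d R v v) / g"
proof -
  define x where "x = complex_of_real (sqrt g)"
  define y where "y = complex_of_real (1 / sqrt g)"
  have xy: "x * x = of_real g" "y * y = of_real (1 / g)" "x * y = 1" "cnj x = x" "cnj y = y"
    using g unfolding x_def y_def of_real_mult[symmetric] by (simp_all add: divide_simps flip: of_real_mult)
  have e: "qform d R (\<lambda>i. x * u i + s * (y * v i)) (\<lambda>i. x * u i + s * (y * v i))
      = of_real g * qform d R u u + of_real (1 / g) * qform d R v v + s * (qform d R u v + qform d R v u)"
    if s: "s = 1 \<or> s = - 1" for s
  proof -
    have "qform d R (\<lambda>i. x * u i + s * (y * v i)) (\<lambda>i. x * u i + s * (y * v i))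
      = (x * x) * qform d R u u + (s * s) * (y * y) * qform d R v v + s * (x * y) * (qform d R u v + qform d R v u)"
      using s by (auto simp add: qform_add_left qform_add_right qform_scale_left qform_scale_right xy(4,5) algebra_simps)
    then show ?thesis using s unfolding xy(1-3) by auto
  qed
  have "0 \<le> Re (of_real g * qform d R u u + of_real (1 / g) * qform d R v v + s * (qform d R u v + qform d R v u))"
    if "s = 1 \<or> s = - 1" for s
    unfolding e[OF that, symmetric] by (rule psd_qform_nonneg[OF R])
  from this[of 1] this[of "- 1"] show ?thesis by auto
qed

text \<open>Evaluate the trace norm in an eigenbasis of the difference and split each eigenvector
  into its parts inside and outside the range of the projection. Bounding the cross terms with one
  weight \<open>g\<close> for all eigenvectors keeps the estimate linear in \<open>x k\<close> and
  \<open>y k\<close>, so that it can be summed.\<close>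

lemma gentle_measurement:
  assumes R: "R \<in> carrier_mat d d" "psd d R" "mtrace R = 1"
    and b: "onb d b" and J: "J \<subseteq> {..<d}"
    and p: "p = (\<Sum>k\<in>J. Re (qform d R (b k) (b k)))" "0 < p"
    and g: "0 < g" "1 - p \<le> g\<^sup>2"
  shows "trace_norm (complex_of_real (1 / p) \<cdot>\<^sub>m compress d b J R - R) \<le> 2 * g + 2 * g\<^sup>2"
proof -
  define S where "S = complex_of_real (1 / p) \<cdot>\<^sub>m compress d b J R"
  have S: "S \<in> carrier_mat d d" using compress_carrier by (simp add: S_def)
  have S_re: "qform d S v v = of_real (1 / p) * qform d (compress d b J R) v v" for v
    unfolding S_def by (rule qform_smult_mat[OF compress_carrier])
  have psdS: "psd d S"
    using p psd_compress[OF R(2), of b J] unfolding psd_def S_re by simp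
  have "mat_adjoint (S - R) = mat_adjoint S - mat_adjoint R"
    using S R(1) by (intro eq_matI) (auto simp: mat_adjoint_eq_mat)
  then have "mat_adjoint (S - R) = S - R"
    using psd_hermitian[OF S psdS] psd_hermitian[OF R(1,2)] by simp
  then obtain u where u: "onb d u"
    and tn: "trace_norm (S - R) = (\<Sum>k<d. cmod (qform d (S - R) (u k) (u k)))"
    using trace_norm_hermitian_qform[of "S - R" d] S R(1) by (auto simp: minus_carrier_mat)
  define J' where "J' = {..<d} - J"
  let ?P = "\<lambda>k. onb_proj d b J (u k)" and ?Q = "\<lambda>k. onb_proj d b J' (u k)"
  \<comment> \<open>The form of \<open>R\<close> at the two parts of the \<open>k\<close>-th
    eigenvector. The sums over \<open>k\<close> are traces of compressions, hence \<open>p\<close>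
    and \<open>1 - p\<close> whatever the eigenbasis is.\<close>
  define x where "x k = Re (qform d R (?P k) (?P k))" for k
  define y where "y k = Re (qform d R (?Q k) (?Q k))" for k
  have xy: "0 \<le> x k" "0 \<le> y k" for k by (auto simp: x_def y_def psd_qform_nonneg R(2))
  have sx: "(\<Sum>k<d. x k) = p"
  proof -
    have "(\<Sum>k<d. x k) = Re (\<Sum>k<d. qform d (compress d b J R) (u k) (u k))"
      by (simp add: x_def qform_compress)
    also have "\<dots> = p" unfolding sum_qform_onb[OF u compress_carrier] mtrace_compress[OF b J] p by simp
    finally show ?thesis .
  qed
  have sy: "(\<Sum>k<d. y k) = 1 - p"
  proof -
    have J': "J' \<subseteq> {..<d}" by (auto simp: J'_def)
    have "(\<Sum>k<d. y k) = Re (\<Sum>k<d. qform d (compress d b J' R) (u k) (u k))"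
      by (simp add: y_def qform_compress)
    also have "\<dots> = (\<Sum>k\<in>J'. Re (qform d R (b k) (b k)))"
      unfolding sum_qform_onb[OF u compress_carrier] mtrace_compress[OF b J'] by simp
    also have "\<dots> = (\<Sum>k<d. Re (qform d R (b k) (b k))) - p"
      unfolding J'_def p using J by (simp add: sum_diff)
    also have "(\<Sum>k<d. Re (qform d R (b k) (b k))) = 1"
      using arg_cong[OF sum_qform_onb[OF b R(1)], of Re] R(3) by simp
    finally show ?thesis .
  qed
  have p1: "p \<le> 1" using sy xy sum_nonneg[of "{..<d}" y] by simp
  \<comment> \<open>The three contributions come from rescaling the kept block by
    \<open>1 / p\<close>, from the lost block, and from the cross terms between them.\<close>
  have "cmod (qform d (S - R) (u k) (u k)) \<le> (1 / p - 1) * x k + y k + (g * x k + y k / g)" if "k < d" for k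
  proof -
    have eS: "qform d S (u k) (u k) = of_real (1 / p) * qform d R (?P k) (?P k)"
      unfolding S_re qform_compress ..
    have "qform d R (u k) (u k) = qform d R (\<lambda>i. ?P k i + ?Q k i) (\<lambda>i. ?P k i + ?Q k i)"
      unfolding J'_def using onb_proj_split[OF b J] by (intro qform_cong) simp_all
    then have eR: "qform d R (u k) (u k) = qform d R (?P k) (?P k) + qform d R (?Q k) (?Q k)
        + (qform d R (?P k) (?Q k) + qform d R (?Q k) (?P k))"
      by (simp add: qform_add_left qform_add_right)
    have "qform d (S - R) (u k) (u k) = qform d S (u k) (u k) - qform d R (u k) (u k)"
      by (rule qform_minus_mat[OF S R(1)])
    moreover have "Im \<dots> = 0" by (simp add: psd_qform_real psdS R(2))
    ultimately have "cmod (qform d (S - R) (u k) (u k)) = \<bar>Re (qform d S (u k) (u k)) - Re (qform d R (u k) (u k))\<bar>"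
      by (simp add: cmod_eq_Re)
    also have "\<dots> = \<bar>(1 / p - 1) * x k - y k - Re (qform d R (?P k) (?Q k) + qform d R (?Q k) (?P k))\<bar>"
      unfolding eS eR x_def y_def by (simp add: algebra_simps diff_divide_distrib)
    also have "\<dots> \<le> (1 / p - 1) * x k + y k + \<bar>Re (qform d R (?P k) (?Q k) + qform d R (?Q k) (?P k))\<bar>"
    proof -
      have "0 \<le> (1 / p - 1) * x k" using p p1 xy by (intro mult_nonneg_nonneg) auto
      then show ?thesis using xy(2)[of k] by linarith
    qed
    finally show ?thesis using psd_cross_le[OF R(2) g(1), of "?P k" "?Q k"] unfolding x_def y_def by linarith
  qed
  then have "trace_norm (S - R) \<le> (\<Sum>k<d. (1 / p - 1) * x k + y k + (g * x k + y k / g))"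
    unfolding tn by (intro sum_mono) auto
  also have "\<dots> = (1 / p - 1) * p + (1 - p) + (g * p + (1 - p) / g)"
    unfolding sum.distrib sum_distrib_left[symmetric] sum_divide_distrib[symmetric] sx sy ..
  also have "(1 / p - 1) * p = 1 - p" using p by (simp add: algebra_simps)
  also have "(1 - p) / g \<le> g"
    using g by (simp add: divide_simps power2_eq_square)
  also have "g * p \<le> g * 1" using p1 g by (intro mult_left_mono) auto
  finally show ?thesis using g unfolding S_def by simp
qed

subsection \<open>Registers of qubits\<close>

lemma bit_of_less_2 [simp]: "bit_of k j < 2"
  by (simp add: bit_of_def)

lemma bit_of_in_01 [simp]: "bit_of k j \<in> {0, 1}"
  using bit_of_less_2[of k j] by (auto simp del: bit_of_less_2)

lemma bit_sum_less:
  assumes "\<And>j. j < K \<Longrightarrow> x j < 2"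
  shows "(\<Sum>j<K. x j * 2 ^ j) < (2::nat) ^ K"
  using assms
proof (induction K)
  case (Suc K)
  have "x K * 2 ^ K \<le> 1 * 2 ^ K" using Suc.prems[of K] by (intro mult_right_mono) auto
  moreover have "(\<Sum>j<K. x j * 2 ^ j) < 2 ^ K" using Suc by simp
  ultimately show ?case by (simp only: sum.lessThan_Suc power_Suc)
qed simp

lemma bit_of_bit_sum:
  assumes "\<And>j. j < K \<Longrightarrow> x j < 2" "j < K"
  shows "bit_of (\<Sum>j<K. x j * 2 ^ j) j = x j"
  using assms
proof (induction K)
  case (Suc K)
  define S where "S = (\<Sum>j<K. x j * 2 ^ j)"
  have S: "S < 2 ^ K" unfolding S_def using Suc.prems by (intro bit_sum_less) auto
  show ?case
  proof (cases "j = K")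
    case True
    have "(S + x K * 2 ^ K) div 2 ^ K = x K" using S by simp
    then show ?thesis using True Suc.prems(1)[of K] by (simp add: bit_of_def S_def[symmetric])
  next
    case False
    then have j: "j < K" using Suc.prems by simp
    \<comment> \<open>After division by \<open>2 ^ j\<close> the top bit contributes an even number,
      which the reduction modulo 2 in \<open>bit_of\<close> discards.\<close>
    have e: "x K * 2 ^ K = (2 * (x K * 2 ^ (K - Suc j))) * 2 ^ j"
      using j by (simp add: power_add[symmetric] mult.assoc flip: power_Suc)
    have "(S + x K * 2 ^ K) div 2 ^ j = S div 2 ^ j + 2 * (x K * 2 ^ (K - Suc j))"
      unfolding e by simp
    then have "bit_of (S + x K * 2 ^ K) j = bit_of S j" by (simp add: bit_of_def)
    then show ?thesis using Suc j by (simp add: S_def)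
  qed
qed simp

lemma bit_expansion: "k < 2 ^ K \<Longrightarrow> (\<Sum>j<K. bit_of k j * 2 ^ j) = k"
proof -
  have "(\<Sum>j<K. bit_of k j * 2 ^ j) = k mod 2 ^ K"
  proof (induction K)
    case (Suc K)
    have "k mod (2 ^ K * 2) = 2 ^ K * (k div 2 ^ K mod 2) + k mod 2 ^ K" by (rule mod_mult2_eq)
    then show ?case using Suc by (simp add: bit_of_def mult.commute)
  qed simp
  then show "k < 2 ^ K \<Longrightarrow> ?thesis" by simp
qed

lemma bit_of_eqI:
  assumes "k < 2 ^ K" "l < 2 ^ K" "\<And>j. j < K \<Longrightarrow> bit_of k j = bit_of l j"
  shows "k = l"
proof -
  have "(\<Sum>j<K. bit_of k j * 2 ^ j) = (\<Sum>j<K. bit_of l j * 2 ^ j)"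
    using assms(3) by (intro sum.cong) auto
  then show ?thesis using bit_expansion assms(1,2) by simp
qed

text \<open>Turns sums over indices into sums over bit assignments, where products over the qubits
  can be distributed.\<close>

lemma bij_betw_bits:
  "bij_betw (\<lambda>k. restrict (bit_of k) {..<K}) {..<2 ^ K} ({..<K} \<rightarrow>\<^sub>E {0, 1})"
proof (rule bij_betw_byWitness[where f' = "\<lambda>x. \<Sum>j<K. x j * 2 ^ j"])
  have lt: "x j < 2" if "x \<in> {..<K} \<rightarrow>\<^sub>E {0, 1}" "j < K" for x :: "nat \<Rightarrow> nat" and j
    using PiE_mem[OF that(1), of j] that(2) by auto
  show "\<forall>x\<in>{..<K} \<rightarrow>\<^sub>E {0, 1}. restrict (bit_of (\<Sum>j<K. x j * 2 ^ j)) {..<K} = x"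
  proof
    fix x :: "nat \<Rightarrow> nat" assume x: "x \<in> {..<K} \<rightarrow>\<^sub>E {0, 1}"
    show "restrict (bit_of (\<Sum>j<K. x j * 2 ^ j)) {..<K} = x"
      by (rule extensionalityI[of _ "{..<K}"]) (use x lt[OF x] in \<open>auto simp: bit_of_bit_sum PiE_def\<close>)
  qed
  show "(\<lambda>x::nat \<Rightarrow> nat. \<Sum>j<K. x j * 2 ^ j) ` ({..<K} \<rightarrow>\<^sub>E {0, 1}) \<subseteq> {..<2 ^ K}"
    using lt by (auto intro!: bit_sum_less)
  show "(\<lambda>k. restrict (bit_of k) {..<K}) ` {..<2 ^ K} \<subseteq> {..<K} \<rightarrow>\<^sub>E {0, 1}"
    by (simp only: image_subset_iff restrict_PiE_iff bit_of_in_01) simp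
qed (auto simp: bit_expansion)

section \<open>Product bases of a register\<close>

definition pvec :: "nat \<Rightarrow> (nat \<Rightarrow> nat \<Rightarrow> complex) \<Rightarrow> nat \<Rightarrow> nat \<Rightarrow> complex" where
  "pvec n N j i = (\<Prod>l<n. N (bit_of j l) (bit_of i l))"

text \<open>The product over qubits distributes over the sum over bit strings. Two measurements are
  allowed, because \<open>M = N\<close> gives orthonormality and the mixed case gives the overlap
  bound.\<close>

lemma inner_pvec:
  "(\<Sum>i<2 ^ n. cnj (pvec n M k i) * pvec n N l i) = (\<Prod>s<n. inner2 (M (bit_of k s)) (N (bit_of l s)))"
proof -
  let ?f = "\<lambda>s c. cnj (M (bit_of k s) c) * N (bit_of l s) c"
  have "(\<Sum>i<2 ^ n. cnj (pvec n M k i) * pvec n N l i)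
      = (\<Sum>i<2 ^ n. (\<lambda>x. \<Prod>s<n. ?f s (x s)) (restrict (bit_of i) {..<n}))"
    by (simp add: pvec_def prod.distrib)
  also have "\<dots> = (\<Sum>x\<in>{..<n} \<rightarrow>\<^sub>E {0, 1}. \<Prod>s<n. ?f s (x s))"
    by (rule sum.reindex_bij_betw[OF bij_betw_bits])
  also have "\<dots> = (\<Prod>s<n. \<Sum>c\<in>{0, 1}. ?f s c)"
    by (rule prod_sum_PiE[symmetric]) auto
  also have "\<dots> = (\<Prod>s<n. inner2 (M (bit_of k s)) (N (bit_of l s)))"
    by (simp add: inner2_def numeral_2_eq_2)
  finally show ?thesis .
qed

lemma onb_pvec:
  assumes "onb2 N"
  shows "onb (2 ^ n) (pvec n N)"
  unfolding onb_def inner_pvec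
proof (intro allI impI)
  fix k l :: nat assume kl: "k < 2 ^ n" "l < 2 ^ n"
  have "(\<Prod>s<n. inner2 (N (bit_of k s)) (N (bit_of l s))) = (\<Prod>s<n. if bit_of k s = bit_of l s then 1 else 0)"
    using assms by (intro prod.cong) (auto simp: onb2_def)
  also have "\<dots> = (if k = l then 1 else 0)"
    using bit_of_eqI[OF kl] by (auto intro!: prod_zero)
  finally show "(\<Prod>s<n. inner2 (N (bit_of k s)) (N (bit_of l s))) = (if k = l then 1 else 0)" .
qed

lemma outcome_prob_eq_qform:
  "outcome_prob n N \<sigma> j = Re (qform (2 ^ n) \<sigma> (pvec n N j) (pvec n N j))"
  unfolding outcome_prob_def qform_def pvec_def Let_def ..

section \<open>Splitting a register into sampled and remaining qubits\<close>

context
  fixes K n :: nat and t :: "nat set"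
  assumes t: "t \<subseteq> {0..<K}" and ct: "K - card t = n"
begin

definition rest_qubit :: "nat \<Rightarrow> nat" where
  "rest_qubit l = sorted_list_of_set ({0..<K} - t) ! l"

lemma finite_sample: "finite t"
  using t finite_subset by blast

lemma card_rest: "card ({0..<K} - t) = n"
  using t ct by (simp add: card_Diff_subset finite_sample)

lemma bij_betw_rest: "bij_betw rest_qubit {..<n} ({..<K} - t)"
  unfolding rest_qubit_def[abs_def] using bij_betw_nth[of "sorted_list_of_set ({0..<K} - t)" "{..<n}" "{0..<K} - t"]
  by (simp add: card_rest lessThan_atLeast0)

lemma prod_sample_rest:
  fixes f :: "nat \<Rightarrow> 'a :: comm_monoid_mult"
  shows "(\<Prod>j<K. f j) = (\<Prod>j\<in>t. f j) * (\<Prod>l<n. f (rest_qubit l))"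
proof -
  have "t \<subseteq> {..<K}" using t by auto
  then have "(\<Prod>j<K. f j) = (\<Prod>j\<in>{..<K} - t. f j) * (\<Prod>j\<in>t. f j)"
    by (intro prod.subset_diff) auto
  also have "(\<Prod>j\<in>{..<K} - t. f j) = (\<Prod>l<n. f (rest_qubit l))"
    using prod.reindex_bij_betw[OF bij_betw_rest, of f] by simp
  finally show ?thesis by (simp add: mult.commute)
qed

lemma
  assumes x: "x \<in> t \<rightarrow>\<^sub>E {0, 1}"
  shows merge_idx_less: "merge_idx K t x i < 2 ^ K"
    and bit_merge_sample: "j \<in> t \<Longrightarrow> bit_of (merge_idx K t x i) j = x j"
    and bit_merge_rest: "l < n \<Longrightarrow> bit_of (merge_idx K t x i) (rest_qubit l) = bit_of i l"
proof -
  \<comment> \<open>The bit assignment of the whole register, with which \<open>merge_idx\<close>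
    becomes an ordinary binary expansion.\<close>
  define z where "z j = (if j \<in> t then x j else bit_of i (the_inv_into {..<n} rest_qubit j))" for j
  have inj: "inj_on rest_qubit {..<n}" and im: "rest_qubit ` {..<n} = {..<K} - t"
    using bij_betw_rest by (auto simp: bij_betw_def)
  have zr: "z (rest_qubit l) = bit_of i l" if "l < n" for l
  proof -
    have "rest_qubit l \<notin> t" using im that by auto
    then show ?thesis using inj that by (simp add: z_def the_inv_into_f_f)
  qed
  have z2: "z j < 2" for j
    using PiE_mem[OF x, of j] by (auto simp: z_def)
  have tK: "t \<subseteq> {..<K}" using t by auto
  have "merge_idx K t x i = (\<Sum>j\<in>t. z j * 2 ^ j) + (\<Sum>l<n. z (rest_qubit l) * 2 ^ rest_qubit l)"
    unfolding merge_idx_def card_rest using zr by (simp add: z_def rest_qubit_def)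
  also have "(\<Sum>l<n. z (rest_qubit l) * 2 ^ rest_qubit l) = (\<Sum>j\<in>{..<K} - t. z j * 2 ^ j)"
    using sum.reindex_bij_betw[OF bij_betw_rest, of "\<lambda>j. z j * 2 ^ j"] by simp
  also have "(\<Sum>j\<in>t. z j * 2 ^ j) + \<dots> = (\<Sum>j<K. z j * 2 ^ j)"
    using sum.subset_diff[OF tK, of "\<lambda>j. z j * 2 ^ j"] by simp
  finally have m: "merge_idx K t x i = (\<Sum>j<K. z j * 2 ^ j)" .
  show "merge_idx K t x i < 2 ^ K" unfolding m by (intro bit_sum_less z2)
  show "bit_of (merge_idx K t x i) j = x j" if "j \<in> t"
    unfolding m using that tK by (subst bit_of_bit_sum) (auto simp: z2, simp add: z_def)
  show "bit_of (merge_idx K t x i) (rest_qubit l) = bit_of i l" if "l < n"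
    unfolding m using that im zr by (subst bit_of_bit_sum) (auto simp: z2)
qed

text \<open>The bits of the merged index determine both arguments, which gives injectivity;
  surjectivity follows by counting.\<close>

lemma bij_betw_merge_idx:
  "bij_betw (\<lambda>(x, i). merge_idx K t x i) ((t \<rightarrow>\<^sub>E {0, 1}) \<times> {..<2 ^ n}) {..<2 ^ K}"
proof -
  let ?f = "\<lambda>(x, i). merge_idx K t x i" and ?A = "(t \<rightarrow>\<^sub>E {0, 1::nat}) \<times> {..<2 ^ n :: nat}"
  have inj: "inj_on ?f ?A"
  proof (rule inj_onI)
    fix p p' assume p: "p \<in> ?A" "p' \<in> ?A" "?f p = ?f p'"
    obtain x i x' i' where pp: "p = (x, i)" "p' = (x', i')" by (cases p, cases p')
    then have x: "x \<in> t \<rightarrow>\<^sub>E {0, 1}" and x': "x' \<in> t \<rightarrow>\<^sub>E {0, 1}"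
      and i: "i < 2 ^ n" "i' < 2 ^ n" and eq: "merge_idx K t x i = merge_idx K t x' i'"
      using p by auto
    have "x = x'"
      using x x' bit_merge_sample[OF x, of _ i] bit_merge_sample[OF x', of _ i'] eq
      by (intro PiE_ext[OF x x']) metis
    moreover have "i = i'"
    proof (rule bit_of_eqI[of _ n])
      fix l assume l: "l < n"
      show "bit_of i l = bit_of i' l"
        using bit_merge_rest[OF x l, of i] bit_merge_rest[OF x' l, of i'] unfolding eq by simp
    qed (use i in auto)
    ultimately show "p = p'" by (simp add: pp)
  qed
  have sub: "?f ` ?A \<subseteq> {..<2 ^ K}" using merge_idx_less by auto
  have "card t \<le> K" using t card_mono[of "{0..<K}" t] by simp
  then have "card t + n = K" using ct by simp
  then have "card ?A = 2 ^ K"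
    using finite_sample by (simp add: card_PiE card_cartesian_product numeral_2_eq_2 flip: power_add)
  then have "card (?f ` ?A) = card {..<2 ^ K :: nat}" using card_image[OF inj] by simp
  then have "?f ` ?A = {..<2 ^ K}" using sub by (intro card_subset_eq) auto
  then show ?thesis using inj by (simp add: bij_betw_def)
qed

lemma sum_merge_idx:
  fixes f :: "nat \<Rightarrow> 'a :: comm_monoid_add"
  shows "(\<Sum>k<2 ^ K. f k) = (\<Sum>x\<in>t \<rightarrow>\<^sub>E {0, 1}. \<Sum>i<2 ^ n. f (merge_idx K t x i))"
proof -
  have "(\<Sum>k<2 ^ K. f k) = (\<Sum>p\<in>(t \<rightarrow>\<^sub>E {0, 1}) \<times> {..<2 ^ n}. f ((\<lambda>(x, i). merge_idx K t x i) p))"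
    by (rule sum.reindex_bij_betw[OF bij_betw_merge_idx, symmetric])
  also have "\<dots> = (\<Sum>x\<in>t \<rightarrow>\<^sub>E {0, 1}. \<Sum>i<2 ^ n. f (merge_idx K t x i))"
    by (subst sum.cartesian_product) (auto intro!: sum.cong)
  finally show ?thesis .
qed

lemma pvec_merge_idx:
  assumes "q \<in> t \<rightarrow>\<^sub>E {0, 1}" "x \<in> t \<rightarrow>\<^sub>E {0, 1}"
  shows "pvec K M (merge_idx K t q y) (merge_idx K t x i) = (\<Prod>j\<in>t. M (q j) (x j)) * pvec n M y i"
  unfolding pvec_def prod_sample_rest using assms
  by (simp add: bit_merge_sample bit_merge_rest)

text \<open>The vector \<open>|M_q> \<otimes> u\<close> of the whole register.\<close>
definition lift_vec :: "(nat \<Rightarrow> nat \<Rightarrow> complex) \<Rightarrow> (nat \<Rightarrow> nat) \<Rightarrow> (nat \<Rightarrow> complex) \<Rightarrow> nat \<Rightarrow> complex" where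
  "lift_vec M q u k = (\<Prod>j\<in>t. M (q j) (bit_of k j)) * u (\<Sum>l<n. bit_of k (rest_qubit l) * 2 ^ l)"

lemma lift_vec_merge_idx:
  assumes "x \<in> t \<rightarrow>\<^sub>E {0, 1}" "i < 2 ^ n"
  shows "lift_vec M q u (merge_idx K t x i) = (\<Prod>j\<in>t. M (q j) (x j)) * u i"
  using assms by (simp add: lift_vec_def bit_merge_sample bit_merge_rest bit_expansion)

text \<open>\<open>post_unnorm\<close> is the form of \<open>\<rho>\<close> pulled back along
  \<open>lift_vec\<close>, by reordering the four sums. Positivity and outcome statistics thereby
  transfer from \<open>\<rho>\<close>.\<close>

lemma qform_post_unnorm:
  "qform (2 ^ n) (post_unnorm K \<rho> M t q) u v = qform (2 ^ K) \<rho> (lift_vec M q u) (lift_vec M q v)"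
proof -
  let ?X = "t \<rightarrow>\<^sub>E {0, 1::nat}" and ?D = "{..<2 ^ n :: nat}"
  define F where "F x i x' i' = cnj ((\<Prod>j\<in>t. M (q j) (x j)) * u i) * \<rho> $$ (merge_idx K t x i, merge_idx K t x' i')
       * ((\<Prod>j\<in>t. M (q j) (x' j)) * v i')" for x i x' i'
  have "qform (2 ^ K) \<rho> (lift_vec M q u) (lift_vec M q v) = (\<Sum>x\<in>?X. \<Sum>i\<in>?D. \<Sum>x'\<in>?X. \<Sum>i'\<in>?D. F x i x' i')"
    unfolding qform_def sum_merge_idx F_def by (intro sum.cong refl) (simp add: lift_vec_merge_idx)
  also have "\<dots> = (\<Sum>i\<in>?D. \<Sum>x\<in>?X. \<Sum>x'\<in>?X. \<Sum>i'\<in>?D. F x i x' i')"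
    by (rule sum.swap)
  also have "\<dots> = (\<Sum>i\<in>?D. \<Sum>x\<in>?X. \<Sum>i'\<in>?D. \<Sum>x'\<in>?X. F x i x' i')"
    by (rule sum.cong[OF refl], rule sum.cong[OF refl]) (rule sum.swap)
  also have "\<dots> = (\<Sum>i\<in>?D. \<Sum>i'\<in>?D. \<Sum>x\<in>?X. \<Sum>x'\<in>?X. F x i x' i')"
    by (rule sum.cong[OF refl]) (rule sum.swap)
  also have "\<dots> = qform (2 ^ n) (post_unnorm K \<rho> M t q) u v"
    unfolding qform_def post_unnorm_def ct F_def
    by (intro sum.cong refl) (simp add: sum_distrib_left sum_distrib_right prod.distrib mult_ac)
  finally show ?thesis ..
qed

lemma post_unnorm_carrier: "post_unnorm K \<rho> M t q \<in> carrier_mat (2 ^ n) (2 ^ n)"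
  by (simp add: post_unnorm_def ct)

lemma psd_post_unnorm: "psd (2 ^ K) \<rho> \<Longrightarrow> psd (2 ^ n) (post_unnorm K \<rho> M t q)"
  by (simp add: psd_def qform_post_unnorm)

text \<open>Lifting a product vector of the rest yields the product vector of the merged string. So
  measuring the sample and then the rest with \<open>M\<close> has the same joint statistics as
  measuring the whole register with \<open>M\<close>, which is what makes the sampling argument
  classical.\<close>

lemma qform_post_unnorm_pvec:
  assumes q: "q \<in> t \<rightarrow>\<^sub>E {0, 1}"
  shows "qform (2 ^ n) (post_unnorm K \<rho> M t q) (pvec n M y) (pvec n M y)
       = qform (2 ^ K) \<rho> (pvec K M (merge_idx K t q y)) (pvec K M (merge_idx K t q y))"
proof -
  have "lift_vec M q (pvec n M y) k = pvec K M (merge_idx K t q y) k" if k: "k < 2 ^ K" for k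
  proof -
    have "k \<in> (\<lambda>(x, i). merge_idx K t x i) ` ((t \<rightarrow>\<^sub>E {0, 1}) \<times> {..<2 ^ n})"
      unfolding bij_betw_imp_surj_on[OF bij_betw_merge_idx] using k by simp
    then obtain p where p: "p \<in> (t \<rightarrow>\<^sub>E {0, 1}) \<times> {..<2 ^ n}" "k = (case p of (x, i) \<Rightarrow> merge_idx K t x i)"
      by (rule imageE)
    obtain x i where "p = (x, i)" by (cases p)
    with p have "x \<in> t \<rightarrow>\<^sub>E {0, 1}" "i < 2 ^ n" "k = merge_idx K t x i" by simp_all
    then show ?thesis using q by (simp add: lift_vec_merge_idx pvec_merge_idx)
  qed
  then show ?thesis unfolding qform_post_unnorm by (intro qform_cong)
qed

end

subsection \<open>Min-entropy\<close>

lemma onb2_iff_onb: "onb2 b \<longleftrightarrow> onb 2 b"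
  by (simp add: onb2_def onb_def inner2_def)

lemma finite_overlaps: "finite {(cmod (inner2 (M x) (N y)))\<^sup>2 | x y. x < (2::nat) \<and> y < (2::nat)}"
proof -
  have "{(cmod (inner2 (M x) (N y)))\<^sup>2 | x y. x < (2::nat) \<and> y < (2::nat)}
      \<subseteq> (\<lambda>(x, y). (cmod (inner2 (M x) (N y)))\<^sup>2) ` ({..<2} \<times> {..<2})" by auto
  then show ?thesis by (rule finite_subset) auto
qed

lemma inner2_le_overlap:
  assumes "x < 2" "y < 2"
  shows "(cmod (inner2 (M x) (N y)))\<^sup>2 \<le> overlap M N"
  unfolding overlap_def using assms by (intro Max_ge finite_overlaps) blast

text \<open>Otherwise \<open>N 0\<close> would be orthogonal to both vectors of a basis and hence
  zero. Positivity is what lets the logarithm of the overlap be split off.\<close>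

lemma overlap_pos:
  assumes M: "onb2 M" and N: "onb2 N"
  shows "overlap M N > 0"
proof (rule ccontr)
  assume "\<not> overlap M N > 0"
  then have z: "inner2 (M k) (N 0) = 0" if "k < 2" for k
    using inner2_le_overlap[of k 0 M N] that by (metis not_less order.trans pos2 zero_less_power2 norm_eq_zero)
  have "N 0 i = 0" if "i < 2" for i
  proof -
    have "N 0 i = onb_proj 2 M {..<2} (N 0) i + onb_proj 2 M ({..<2} - {..<2}) (N 0) i"
      using M that onb_proj_split[of 2 M "{..<2}" i "N 0"] by (simp add: onb2_iff_onb)
    also have "\<dots> = (\<Sum>k<2. inner2 (M k) (N 0) * M k i)"
      by (simp add: onb_proj_def inner2_def)
    also have "\<dots> = 0" using z by simp
    finally show ?thesis .
  qed
  then have "inner2 (N 0) (N 0) = 0" by (simp add: inner2_def)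
  then show False using N by (simp add: onb2_def)
qed

lemma outcome_set_eq: "{outcome_prob n N \<sigma> j | j. j < 2 ^ n} = outcome_prob n N \<sigma> ` {..<2 ^ n}"
  by auto

lemma outcome_prob_nonneg:
  assumes "density_op n \<sigma>"
  shows "0 \<le> outcome_prob n N \<sigma> j"
  using assms by (simp add: outcome_prob_eq_qform density_op_iff_psd psd_qform_nonneg)

lemma sum_outcome_prob:
  assumes "density_op n \<sigma>" "onb2 N"
  shows "(\<Sum>j<2 ^ n. outcome_prob n N \<sigma> j) = 1"
  using arg_cong[OF sum_qform_onb[OF onb_pvec[OF assms(2), of n], of \<sigma>], of Re] assms(1)
  by (simp add: density_op_iff_psd outcome_prob_eq_qform)

lemma Max_outcome_prob_ge:
  assumes "density_op n \<sigma>" "onb2 N"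
  shows "1 / 2 ^ n \<le> Max {outcome_prob n N \<sigma> j | j. j < 2 ^ n}"
proof -
  let ?M = "Max {outcome_prob n N \<sigma> j | j. j < 2 ^ n}"
  have "1 = (\<Sum>j<2 ^ n. outcome_prob n N \<sigma> j)" using sum_outcome_prob[OF assms] by simp
  also have "\<dots> \<le> (\<Sum>j<(2::nat) ^ n. ?M)"
    unfolding outcome_set_eq by (intro sum_mono Max_ge) auto
  finally show ?thesis by (simp add: field_simps)
qed

text \<open>The largest of \<open>2 ^ n\<close> probabilities is at least their average. This makes
  the set in \<open>Hmin_smooth\<close> bounded above, as \<open>cSup_upper\<close>
  requires.\<close>

lemma Hmin_le:
  assumes "density_op n \<sigma>" "onb2 N"
  shows "Hmin n N \<sigma> \<le> real n"
proof -
  have "log 2 (1 / 2 ^ n) \<le> log 2 (Max {outcome_prob n N \<sigma> j | j. j < 2 ^ n})"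
    using Max_outcome_prob_ge[OF assms] by (intro log_mono) auto
  then show ?thesis by (simp add: Hmin_def log_divide log_nat_power)
qed

lemma Hmin_ge:
  assumes "density_op n \<sigma>" "onb2 N" and B: "\<And>j. j < 2 ^ n \<Longrightarrow> outcome_prob n N \<sigma> j \<le> B"
  shows "- log 2 B \<le> Hmin n N \<sigma>"
proof -
  have "Max {outcome_prob n N \<sigma> j | j. j < 2 ^ n} \<le> B"
    unfolding outcome_set_eq using B by (intro Max.boundedI) (auto simp: lessThan_empty_iff)
  moreover have "0 < Max {outcome_prob n N \<sigma> j | j. j < 2 ^ n}"
    by (rule less_le_trans[OF _ Max_outcome_prob_ge[OF assms(1,2)]]) simp
  ultimately show ?thesis unfolding Hmin_def by (simp add: log_mono)
qed

lemma Hmin_smooth_ge: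
  assumes "density_op n \<sigma>" "onb2 N" "trace_norm (\<sigma> - \<rho>) \<le> e"
  shows "Hmin n N \<sigma> \<le> Hmin_smooth n e N \<rho>"
  unfolding Hmin_smooth_def using assms Hmin_le
  by (intro cSup_upper bdd_aboveI[of _ "real n"]) auto

text \<open>The smoothing state is the normalised compression of \<open>\<tau>\<close> to the
  \<open>M\<close>-strings in \<open>J\<close>: \<open>gentle_measurement\<close> bounds its
  distance from \<open>\<tau>\<close>, and \<open>qform_compress_le\<close> bounds its outcome
  probabilities for \<open>N\<close>.\<close>

lemma Hmin_smooth_ge_of_concentrated:
  assumes \<tau>: "density_op n \<tau>" and M: "onb2 M" and N: "onb2 N" and J: "J \<subseteq> {..<2 ^ n}"
    and p: "1 - (\<Sum>k\<in>J. outcome_prob n M \<tau> k) \<le> g\<^sup>2" and g: "0 < g" "g < 1" and e: "2 * g + 2 * g\<^sup>2 \<le> e"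
  shows "card J > 0" "- log 2 (real (card J)) - real n * log 2 (overlap M N) \<le> Hmin_smooth n e N \<tau>"
proof -
  define b where "b = pvec n M"
  define p where "p = (\<Sum>k\<in>J. Re (qform (2 ^ n) \<tau> (b k) (b k)))"
  have pp: "1 - p \<le> g\<^sup>2" using p by (simp add: p_def b_def outcome_prob_eq_qform)
  \<comment> \<open>\<open>g < 1\<close> leaves positive mass on \<open>J\<close>, so that the
    compression can be normalised and \<open>J\<close> is nonempty.\<close>
  moreover have "g\<^sup>2 < 1" using g by (simp add: power_less_one_iff)
  ultimately have p0: "0 < p" by linarith
  have fJ: "finite J" using J finite_subset by blast
  show cJ: "card J > 0" using p0 fJ by (auto simp: p_def card_gt_0_iff)
  have \<tau>': "\<tau> \<in> carrier_mat (2 ^ n) (2 ^ n)" "psd (2 ^ n) \<tau>" "mtrace \<tau> = 1"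
    using \<tau> by (auto simp: density_op_iff_psd)
  have b: "onb (2 ^ n) b" unfolding b_def by (rule onb_pvec[OF M])
  define C where "C = compress (2 ^ n) b J \<tau>"
  define \<sigma> where "\<sigma> = complex_of_real (1 / p) \<cdot>\<^sub>m C"
  have C: "C \<in> carrier_mat (2 ^ n) (2 ^ n)" unfolding C_def by (rule compress_carrier)
  have \<sigma>q: "qform (2 ^ n) \<sigma> v v = of_real (1 / p) * qform (2 ^ n) C v v" for v
    unfolding \<sigma>_def by (rule qform_smult_mat[OF C])
  have "density_op n \<sigma>"
    unfolding density_op_iff_psd
  proof (intro conjI)
    show "\<sigma> \<in> carrier_mat (2 ^ n) (2 ^ n)" using C by (simp add: \<sigma>_def)
    show "psd (2 ^ n) \<sigma>"
      using psd_compress[OF \<tau>'(2), of b J] p0 unfolding psd_def \<sigma>q C_def by simp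
    have "mtrace \<sigma> = of_real (1 / p) * mtrace C"
      using C by (simp add: mtrace_def \<sigma>_def sum_distrib_left)
    also have "mtrace C = of_real p"
      unfolding C_def mtrace_compress[OF b J] p_def of_real_sum
      using psd_qform_real[OF \<tau>'(2)] by (intro sum.cong) (auto simp: complex_eq_iff)
    finally show "mtrace \<sigma> = 1" using p0 by simp
  qed
  moreover have "trace_norm (\<sigma> - \<tau>) \<le> e"
    using gentle_measurement[OF \<tau>' b J p_def p0 g(1) pp] e unfolding \<sigma>_def C_def by linarith
  moreover have "outcome_prob n N \<sigma> j \<le> real (card J) * overlap M N ^ n" if "j < 2 ^ n" for j
  proof -
    \<comment> \<open>The factor \<open>p\<close> cancels against the normalisation
      \<open>1 / p\<close> of \<open>\<sigma>\<close>.\<close>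
    have "Re (qform (2 ^ n) C (pvec n N j) (pvec n N j)) \<le> real (card J) * overlap M N ^ n * p"
      unfolding C_def p_def
    proof (rule qform_compress_le[OF \<tau>'(2) J])
      fix k
      have "(cmod (\<Sum>l<2 ^ n. cnj (b k l) * pvec n N j l))\<^sup>2
          = (\<Prod>s<n. (cmod (inner2 (M (bit_of k s)) (N (bit_of j s))))\<^sup>2)"
        unfolding b_def inner_pvec by (simp add: prod_norm[symmetric] prod_power_distrib)
      also have "\<dots> \<le> (\<Prod>s<n. overlap M N)"
        by (intro prod_mono) (simp add: inner2_le_overlap)
      finally show "(cmod (\<Sum>l<2 ^ n. cnj (b k l) * pvec n N j l))\<^sup>2 \<le> overlap M N ^ n" by simp
    qed
    then show ?thesis
      using p0 unfolding outcome_prob_eq_qform \<sigma>q by (simp add: field_simps)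
  qed
  ultimately have "- log 2 (real (card J) * overlap M N ^ n) \<le> Hmin_smooth n e N \<tau>"
    using Hmin_ge[OF _ N] Hmin_smooth_ge[OF _ N] order.trans by metis
  moreover have "log 2 (real (card J) * overlap M N ^ n) = log 2 (real (card J)) + real n * log 2 (overlap M N)"
    using cJ overlap_pos[OF M N] by (subst log_mult) (auto simp: log_nat_power)
  ultimately show "- log 2 (real (card J)) - real n * log 2 (overlap M N) \<le> Hmin_smooth n e N \<tau>" by simp
qed

text \<open>Taking the trace over the rest in the product basis of \<open>M\<close> exhibits the
  probability of \<open>q\<close> as a marginal of the distribution of the full
  \<open>M\<close>-string.\<close>

lemma meas_prob_eq_sum:
  assumes t: "t \<subseteq> {0..<K}" "K - card t = n" and M: "onb2 M" and q: "q \<in> t \<rightarrow>\<^sub>E {0, 1}"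
  shows "meas_prob K \<rho> M t q = (\<Sum>y<2 ^ n. outcome_prob K M \<rho> (merge_idx K t q y))"
proof -
  have "mtrace (post_unnorm K \<rho> M t q)
      = (\<Sum>y<2 ^ n. qform (2 ^ n) (post_unnorm K \<rho> M t q) (pvec n M y) (pvec n M y))"
    using sum_qform_onb[OF onb_pvec[OF M] post_unnorm_carrier[OF t]] by simp
  then show ?thesis
    unfolding meas_prob_def outcome_prob_eq_qform qform_post_unnorm_pvec[OF t q] by simp
qed

lemma density_op_post_state:
  assumes t: "t \<subseteq> {0..<K}" "K - card t = n" and \<rho>: "density_op K \<rho>" and pos: "meas_prob K \<rho> M t q > 0"
  shows "density_op n (post_state K \<rho> M t q)"
  unfolding density_op_iff_psd
proof (intro conjI)
  let ?R = "post_unnorm K \<rho> M t q" and ?mp = "meas_prob K \<rho> M t q"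
  note R = post_unnorm_carrier[OF t, of \<rho> M q]
  have R': "psd (2 ^ n) ?R" using \<rho> by (intro psd_post_unnorm[OF t]) (simp add: density_op_iff_psd)
  show "post_state K \<rho> M t q \<in> carrier_mat (2 ^ n) (2 ^ n)" using R by (simp add: post_state_def)
  show "psd (2 ^ n) (post_state K \<rho> M t q)"
    using R' pos unfolding psd_def post_state_def qform_smult_mat[OF R] by simp
  \<comment> \<open>\<open>meas_prob\<close> keeps only the real part of the trace. Hermiticity
    makes the trace real, so that normalisation gives exactly 1.\<close>
  have "mat_adjoint ?R = ?R" by (rule psd_hermitian[OF R R'])
  then have "cnj (?R $$ (i, i)) = ?R $$ (i, i)" if "i < 2 ^ n" for i
  proof -
    have "mat_adjoint ?R $$ (i, i) = cnj (?R $$ (i, i))"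
      using that R by (simp add: mat_adjoint_eq_mat)
    then show ?thesis using \<open>mat_adjoint ?R = ?R\<close> by simp
  qed
  then have "cnj (mtrace ?R) = mtrace ?R" using R by (simp add: mtrace_def)
  then have "mtrace ?R = of_real ?mp"
    by (simp add: meas_prob_def complex_eq_iff)
  moreover have "mtrace (post_state K \<rho> M t q) = of_real (1 / ?mp) * mtrace ?R"
    using R by (simp add: mtrace_def post_state_def sum_distrib_left)
  ultimately show "mtrace (post_state K \<rho> M t q) = 1" using pos by simp
qed

lemma outcome_prob_post_state:
  assumes t: "t \<subseteq> {0..<K}" "K - card t = n" and q: "q \<in> t \<rightarrow>\<^sub>E {0, 1}"
  shows "outcome_prob n M (post_state K \<rho> M t q) y = outcome_prob K M \<rho> (merge_idx K t q y) / meas_prob K \<rho> M t q"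
  unfolding outcome_prob_eq_qform post_state_def qform_smult_mat[OF post_unnorm_carrier[OF t]]
    qform_post_unnorm_pvec[OF t q] by simp

text \<open>A binary string is determined by the set of positions at which it differs from
  \<open>a\<close>, which reduces the count to subsets of bounded size.\<close>

lemma card_low_weight_strings_le:
  fixes x :: real
  assumes "a \<in> {0, 1}" "0 \<le> x"
  shows "real (card {y. y < 2 ^ n \<and> real (card {l. l < n \<and> bit_of y l \<noteq> a}) \<le> real n * x}) \<le> 2 powr (real n * Hbar x)"
proof -
  let ?J = "{y. y < 2 ^ n \<and> real (card {l. l < n \<and> bit_of y l \<noteq> a}) \<le> real n * x}"
  let ?S = "{S. S \<subseteq> {..<n} \<and> real (card S) \<le> real (card {..<n}) * x}"
  let ?f = "\<lambda>y. {l. l < n \<and> bit_of y l \<noteq> a}"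
  have "inj_on ?f ?J"
  proof (rule inj_onI)
    fix y z assume yz: "y \<in> ?J" "z \<in> ?J" "?f y = ?f z"
    have lt: "y < 2 ^ n" "z < 2 ^ n" using yz(1,2) by blast+
    have "bit_of y l = bit_of z l" if "l < n" for l
    proof -
      have "l \<in> ?f y \<longleftrightarrow> l \<in> ?f z" by (simp only: yz(3))
      then have "bit_of y l = a \<longleftrightarrow> bit_of z l = a" using that by simp
      then show ?thesis
        using bit_of_less_2[of y l] bit_of_less_2[of z l] assms(1) unfolding less_2_cases_iff by auto
    qed
    then show "y = z" by (rule bit_of_eqI[OF lt])
  qed
  moreover have "?f ` ?J \<subseteq> ?S" by auto
  moreover have "finite ?S" by (auto intro: finite_subset[of _ "Pow {..<n}"])
  ultimately have "card ?J \<le> card ?S" by (rule card_inj_on_le)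
  then have "real (card ?J) \<le> real (card ?S)" by simp
  also have "\<dots> \<le> 2 powr (real (card {..<n}) * Hbar x)"
    by (intro card_hamming_ball_le) (auto simp: assms)
  finally show ?thesis by simp
qed

subsection \<open>Sampling a quantum register\<close>

text \<open>The Hamming ball of radius \<open>n * x\<close> around the constant string
  \<open>a\<close>, as a set of basis indices.\<close>

definition low_weight :: "nat \<Rightarrow> nat \<Rightarrow> real \<Rightarrow> nat set" where
  "low_weight n a x = {y. y < 2 ^ n \<and> real (card {l. l < n \<and> bit_of y l \<noteq> a}) \<le> real n * x}"

text \<open>The assumption \<open>bad\<close> uses joint probabilities, which can be summed over
  \<open>q\<close>. Dividing by \<open>meas_prob\<close> turns it into a bound on the mass of the
  post-measurement state outside the ball, and the volume of the ball gives the entropy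
  term.\<close>

lemma Hmin_smooth_post_state_ge:
  assumes t: "t \<subseteq> {0..<K}" "K - card t = n" and \<rho>: "density_op K \<rho>" and M: "onb2 M" and N: "onb2 N"
    and a: "a \<in> {0, 1}" and q: "q \<in> t \<rightarrow>\<^sub>E {0, 1}" and x: "0 \<le> x"
    and mp: "meas_prob K \<rho> M t q > 0"
    and bad: "(\<Sum>y\<in>{..<2 ^ n} - low_weight n a x. outcome_prob K M \<rho> (merge_idx K t q y)) \<le> g\<^sup>2 * meas_prob K \<rho> M t q"
    and g: "0 < g" "g < 1" "2 * g + 2 * g\<^sup>2 \<le> e"
  shows "Hmin_smooth n e N (post_state K \<rho> M t q) + real n * Hbar x \<ge> - real n * log 2 (overlap M N)"
proof -
  let ?\<tau> = "post_state K \<rho> M t q" and ?J = "low_weight n a x" and ?P = "\<lambda>y. outcome_prob K M \<rho> (merge_idx K t q y)"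
  have J: "?J \<subseteq> {..<2 ^ n}" by (auto simp: low_weight_def)
  have "(\<Sum>y\<in>{..<2 ^ n} - ?J. ?P y) = meas_prob K \<rho> M t q - (\<Sum>y\<in>?J. ?P y)"
    unfolding meas_prob_eq_sum[OF t M q] using J by (intro sum_diff) auto
  then have "1 - (\<Sum>y\<in>?J. ?P y) / meas_prob K \<rho> M t q \<le> g\<^sup>2"
    using bad mp by (simp add: field_simps)
  then have p: "1 - (\<Sum>y\<in>?J. outcome_prob n M ?\<tau> y) \<le> g\<^sup>2"
    by (simp add: outcome_prob_post_state[OF t q] sum_divide_distrib)
  note H = Hmin_smooth_ge_of_concentrated[OF density_op_post_state[OF t \<rho> mp] M N J p g]
  have "log 2 (real (card ?J)) \<le> log 2 (2 powr (real n * Hbar x))"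
    using H(1) card_low_weight_strings_le[OF a x, of n] unfolding low_weight_def by (intro log_mono) auto
  then have "log 2 (real (card ?J)) \<le> real n * Hbar x" by simp
  with H(2) show ?thesis by linarith
qed

text \<open>The classical error event for the string \<open>z\<close> of the whole register: the
  sample underestimates the relative weight of the rest by more than \<open>\<delta>\<close>. It is
  multiplied by \<open>n\<close> to match \<open>low_weight\<close>.\<close>

definition bad_sample :: "nat \<Rightarrow> nat \<Rightarrow> nat \<Rightarrow> real \<Rightarrow> nat \<Rightarrow> nat set \<Rightarrow> bool" where
  "bad_sample K n a \<delta> z t \<longleftrightarrow> real n * (real (card {j \<in> t. bit_of z j \<noteq> a}) / real (card t) + \<delta>)
     < real (card {j \<in> {..<K} - t. bit_of z j \<noteq> a})"

text \<open>Underestimating the frequency of letters other than \<open>a\<close> is the same as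
  overestimating the frequency of \<open>a\<close>, so the upper tail applies to the set
  \<open>B\<close> of positions carrying \<open>a\<close>.\<close>

lemma card_bad_samples_le:
  fixes \<delta> :: real
  assumes mn: "1 \<le> m" "m \<le> n" and \<delta>: "0 \<le> \<delta>"
  shows "real (card {t. t \<subseteq> {0..<m + n} \<and> card t = m \<and> bad_sample (m + n) n a \<delta> z t})
       \<le> real ((m + n) choose m) * exp (- \<delta>\<^sup>2 * (real m * real (m + n)) / (real (m + n) + 2))"
proof -
  let ?A = "{0..<m + n}"
  define B where "B = {j \<in> ?A. bit_of z j = a}"
  have "bad_sample (m + n) n a \<delta> z t \<longleftrightarrow> real (card (t \<inter> B)) / real m > real (card (B - t)) / real n + \<delta>"
    if t: "t \<subseteq> ?A" "card t = m" for t
  proof -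
    have fin: "finite t" "finite (?A - t)" using t finite_subset by auto
    define u where "u = card {j \<in> t. bit_of z j \<noteq> a}"
    define w where "w = card {j \<in> {..<m + n} - t. bit_of z j \<noteq> a}"
    have "card t = card (t \<inter> B) + u"
    proof -
      have "t \<inter> B \<union> {j \<in> t. bit_of z j \<noteq> a} = t" "t \<inter> B \<inter> {j \<in> t. bit_of z j \<noteq> a} = {}"
        using t by (auto simp: B_def)
      then show ?thesis unfolding u_def using fin by (metis (no_types, lifting) card_Un_disjoint finite_Un)
    qed
    moreover have "card (?A - t) = card (B - t) + w"
    proof -
      have "(B - t) \<union> {j \<in> {..<m + n} - t. bit_of z j \<noteq> a} = ?A - t"
        "(B - t) \<inter> {j \<in> {..<m + n} - t. bit_of z j \<noteq> a} = {}"
        by (auto simp: B_def)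
      then show ?thesis unfolding w_def using fin by (metis (no_types, lifting) card_Un_disjoint finite_Un)
    qed
    moreover have "card (?A - t) = n" using t fin by (simp add: card_Diff_subset)
    ultimately have e: "real (card (t \<inter> B)) = real m - real u" "real (card (B - t)) = real n - real w"
      using t by linarith+
    have "real m > 0" "real n > 0" using mn by auto
    then show ?thesis
      unfolding bad_sample_def u_def[symmetric] w_def[symmetric] e t(2)
      by (simp add: diff_divide_distrib) (simp add: field_simps)
  qed
  then have "{t. t \<subseteq> ?A \<and> card t = m \<and> bad_sample (m + n) n a \<delta> z t}
      = {t. t \<subseteq> ?A \<and> card t = m \<and> real (card (t \<inter> B)) / real m > real (card (B - t)) / real n + \<delta>}"
    by blast
  moreover have "B \<subseteq> ?A" by (auto simp: B_def)
  ultimately show ?thesis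
    using sampling_tail_le[of ?A m n B \<delta>] mn \<delta> by simp
qed

text \<open>Connects the classical event for the merged string with the ball whose span defines the
  projection.\<close>

lemma bad_sample_merge_idx:
  assumes t: "t \<subseteq> {0..<K}" "K - card t = n" and q: "q \<in> t \<rightarrow>\<^sub>E {0, 1}" and y: "y < 2 ^ n"
  shows "bad_sample K n a \<delta> (merge_idx K t q y) t \<longleftrightarrow> y \<notin> low_weight n a (rel_weight a t q + \<delta>)"
proof -
  let ?z = "merge_idx K t q y" and ?r = "rest_qubit K t"
  have b: "bij_betw ?r {..<n} ({..<K} - t)" by (rule bij_betw_rest[OF t])
  have "{j \<in> {..<K} - t. bit_of ?z j \<noteq> a} = ?r ` {l. l < n \<and> bit_of y l \<noteq> a}"
  proof -
    have "{j \<in> {..<K} - t. bit_of ?z j \<noteq> a} = {j \<in> ?r ` {..<n}. bit_of ?z j \<noteq> a}"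
      unfolding bij_betw_imp_surj_on[OF b] ..
    also have "\<dots> = ?r ` {l. l < n \<and> bit_of y l \<noteq> a}"
      using bit_merge_rest[OF t q] by auto
    finally show ?thesis .
  qed
  moreover have "inj_on ?r {l. l < n \<and> bit_of y l \<noteq> a}"
    using b by (auto simp: bij_betw_def inj_on_def)
  ultimately have c: "card {j \<in> {..<K} - t. bit_of ?z j \<noteq> a} = card {l. l < n \<and> bit_of y l \<noteq> a}"
    by (simp add: card_image)
  have "{j \<in> t. bit_of ?z j \<noteq> a} = {i \<in> t. q i \<noteq> a}"
    using bit_merge_sample[OF t q] by auto
  then show ?thesis
    unfolding bad_sample_def low_weight_def rel_weight_def c using y by auto
qed

text \<open>Reindexing the pairs \<open>(q, y)\<close> by merged strings \<open>z\<close> gives a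
  summation range independent of \<open>t\<close>, so that the average over \<open>t\<close> can
  later be taken for each fixed \<open>z\<close>.\<close>

lemma sum_bad_mass:
  assumes t: "t \<subseteq> {0..<K}" "K - card t = n"
  shows "(\<Sum>q\<in>t \<rightarrow>\<^sub>E {0, 1}. \<Sum>y\<in>{..<2 ^ n} - low_weight n a (rel_weight a t q + \<delta>). P (merge_idx K t q y))
       = (\<Sum>z<2 ^ K. if bad_sample K n a \<delta> z t then P z else (0::real))"
  unfolding sum_merge_idx[OF t]
proof (rule sum.cong[OF refl])
  fix q :: "nat \<Rightarrow> nat" assume q: "q \<in> t \<rightarrow>\<^sub>E {0, 1}"
  have "(\<Sum>y<2 ^ n. if bad_sample K n a \<delta> (merge_idx K t q y) t then P (merge_idx K t q y) else 0)
      = (\<Sum>y<2 ^ n. if y \<in> - low_weight n a (rel_weight a t q + \<delta>) then P (merge_idx K t q y) else 0)"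
    by (rule sum.cong) (simp_all add: bad_sample_merge_idx[OF t q])
  also have "\<dots> = (\<Sum>y\<in>{..<2 ^ n} - low_weight n a (rel_weight a t q + \<delta>). P (merge_idx K t q y))"
    by (simp only: sum.inter_restrict[OF finite_lessThan, symmetric] Diff_eq)
  finally show "(\<Sum>y\<in>{..<2 ^ n} - low_weight n a (rel_weight a t q + \<delta>). P (merge_idx K t q y))
      = (\<Sum>y<2 ^ n. if bad_sample K n a \<delta> (merge_idx K t q y) t then P (merge_idx K t q y) else 0)" ..
qed

section \<open>From the classical sampling bound to the success probability\<close>

theorem theorem2:
  fixes eps epsh beta :: real and a m n :: nat
    and \<rho> :: "complex mat" and M N :: "nat \<Rightarrow> nat \<Rightarrow> complex"
  assumes "0 < eps" and "eps \<le> epsh"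
    and "a \<in> {0, 1}"
    and "0 < beta" and "beta < 1/2"
    and "1 \<le> m" and "m \<le> n"
    and "density_op (m + n) \<rho>"
    and "onb2 M" and "onb2 N"
  shows "let \<delta> = sqrt ((real (m + n) + 2) * ln (2 / eps\<^sup>2) / (real m * real (m + n)));
             c = overlap M N
         in (\<Sum>t\<in>{t. t \<subseteq> {0..<m + n} \<and> card t = m}.
               (1 / real ((m + n) choose m)) *
               (\<Sum>q\<in>{q \<in> t \<rightarrow>\<^sub>E {0, 1}. meas_prob (m + n) \<rho> M t q > 0 \<and>
                      Hmin_smooth n (2 * eps + 2 * eps powr beta) N (post_state (m + n) \<rho> M t q)
                        + real n * Hbar (rel_weight a t q + \<delta>) \<ge> - real n * log 2 c}.
                  meas_prob (m + n) \<rho> M t q))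
            \<ge> 1 - epsh powr (1 - 2 * beta)"
proof -
  define \<delta> where "\<delta> = sqrt ((real (m + n) + 2) * ln (2 / eps\<^sup>2) / (real m * real (m + n)))"
  define K where "K = m + n"
  define mp where "mp t q = meas_prob K \<rho> M t q" for t q
  define G where "G t = {q \<in> t \<rightarrow>\<^sub>E {0, 1}. mp t q > 0 \<and>
      Hmin_smooth n (2 * eps + 2 * eps powr beta) N (post_state K \<rho> M t q)
        + real n * Hbar (rel_weight a t q + \<delta>) \<ge> - real n * log 2 (overlap M N)}" for t
  define T where "T = {t. t \<subseteq> {0..<K} \<and> card t = m}"
  define C where "C = real (K choose m)"
  have C: "C > 0" by (simp add: C_def K_def)
  have cardT: "real (card T) = C" unfolding T_def C_def by (simp add: n_subsets)
  have finT: "finite T" unfolding T_def by (auto intro: finite_subset[of _ "Pow {0..<K}"])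
  have finX: "finite (t \<rightarrow>\<^sub>E {0, 1::nat})" if "t \<in> T" for t
    using that by (intro finite_PiE) (auto simp: T_def dest: finite_subset)
  have "1 - epsh powr (1 - 2 * beta) \<le> (\<Sum>t\<in>T. (1 / C) * (\<Sum>q\<in>G t. mp t q))"
  proof (cases "eps < 1")
    \<comment> \<open>Here \<open>epsh \<ge> eps \<ge> 1\<close>, so the claimed lower bound is at
      most 0.\<close>
    case False
    have "1 \<le> epsh powr (1 - 2 * beta)"
      using False assms by (intro ge_one_powr_ge_zero) auto
    moreover have "0 \<le> (\<Sum>t\<in>T. (1 / C) * (\<Sum>q\<in>G t. mp t q))"
      using C by (intro sum_nonneg mult_nonneg_nonneg) (auto simp: G_def)
    ultimately show ?thesis by linarith
  next
    case True
    \<comment> \<open>\<open>g\<^sup>2\<close> is the Markov threshold: it turns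
      \<open>eps\<^sup>2\<close> into \<open>eps powr (1 - 2 * beta)\<close>, while
      \<open>2 * g + 2 * g\<^sup>2\<close> stays within the smoothing radius.\<close>
    define g where "g = eps powr (1/2 + beta)"
    have g: "0 < g" "g < 1"
      using assms True powr_less_mono2[of "1/2 + beta" eps 1] by (simp_all add: g_def)
    have g2: "g\<^sup>2 = eps powr (1 + 2 * beta)"
      using assms unfolding g_def by (simp add: powr_powr flip: powr_realpow) (simp add: algebra_simps)
    have "g \<le> eps powr beta"
      unfolding g_def using assms True by (intro powr_mono') auto
    moreover have "g\<^sup>2 \<le> eps powr 1"
      unfolding g2 using assms True by (intro powr_mono') auto
    ultimately have ge: "2 * g + 2 * g\<^sup>2 \<le> 2 * eps + 2 * eps powr beta" using assms by simp
    have "eps\<^sup>2 < 2" using True assms power_less_one_iff[of eps 2] by simp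
    \<comment> \<open>Makes the argument of \<open>sqrt\<close> in \<open>\<delta>\<close>
      nonnegative, so that squaring recovers it.\<close>
    then have ln0: "0 < ln (2 / eps\<^sup>2)" using assms by simp
    have Kpos: "real m > 0" "real K > 0" using assms by (auto simp: K_def)
    have \<delta>0: "0 \<le> \<delta>" using ln0 unfolding \<delta>_def by simp
    have \<delta>2: "\<delta>\<^sup>2 = (real K + 2) * ln (2 / eps\<^sup>2) / (real m * real K)"
      unfolding \<delta>_def K_def[symmetric] using ln0 by simp
    \<comment> \<open>\<open>\<delta>\<close> is the value at which the sampling tail bound equals
      \<open>eps\<^sup>2 / 2\<close>.\<close>
    have tail: "exp (- \<delta>\<^sup>2 * (real m * real K) / (real K + 2)) = eps\<^sup>2 / 2"
    proof -
      have "- \<delta>\<^sup>2 * (real m * real K) / (real K + 2) = - ln (2 / eps\<^sup>2)"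
      proof -
        have "x * l / y * y / x = l" if "x > 0" "y > 0" for x y l :: real using that by simp
        from this[of "real K + 2" "real m * real K"] show ?thesis
          unfolding \<delta>2 using Kpos by simp
      qed
      then show ?thesis using assms by (simp add: exp_minus)
    qed
    define P where "P z = outcome_prob K M \<rho> z" for z
    have \<rho>: "density_op K \<rho>" using assms by (simp add: K_def)
    have P0: "0 \<le> P z" for z unfolding P_def by (rule outcome_prob_nonneg[OF \<rho>])
    have P1: "(\<Sum>z<2 ^ K. P z) = 1" unfolding P_def by (rule sum_outcome_prob[OF \<rho> \<open>onb2 M\<close>])
    \<comment> \<open>The joint probability of observing \<open>q\<close> on the sample and a string
      outside the ball on the rest.\<close>
    define bm where "bm t q = (\<Sum>y\<in>{..<2 ^ n} - low_weight n a (rel_weight a t q + \<delta>). P (merge_idx K t q y))" for t q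
    have bm0: "0 \<le> bm t q" for t q unfolding bm_def by (intro sum_nonneg P0)
    have tT: "t \<subseteq> {0..<K}" "K - card t = n" if "t \<in> T" for t using that by (auto simp: T_def K_def)
    have good: "1 - (\<Sum>q\<in>t \<rightarrow>\<^sub>E {0, 1}. bm t q) / g\<^sup>2 \<le> (\<Sum>q\<in>G t. mp t q)" if t: "t \<in> T" for t
    proof -
      have sub: "G t \<subseteq> t \<rightarrow>\<^sub>E {0, 1}" by (auto simp: G_def)
      \<comment> \<open>Markov's inequality without conditioning: an outcome that fails, or has
        probability 0, has probability at most \<open>bm t q / g\<^sup>2\<close>.\<close>
      have "mp t q \<le> bm t q / g\<^sup>2" if q: "q \<in> (t \<rightarrow>\<^sub>E {0, 1}) - G t" for q
      proof (rule ccontr)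
        assume "\<not> mp t q \<le> bm t q / g\<^sup>2"
        then have lt: "bm t q / g\<^sup>2 < mp t q" by simp
        then have pos: "mp t q > 0" using bm0[of t q] g by (smt (verit) divide_nonneg_nonneg zero_le_power2)
        have "bm t q \<le> g\<^sup>2 * mp t q" using lt g by (simp add: field_simps)
        moreover have "0 \<le> rel_weight a t q + \<delta>" using \<delta>0 by (simp add: rel_weight_def)
        ultimately have "q \<in> G t"
          using Hmin_smooth_post_state_ge[OF tT[OF t] \<rho> \<open>onb2 M\<close> \<open>onb2 N\<close> \<open>a \<in> {0, 1}\<close>, of q "rel_weight a t q + \<delta>" g
              "2 * eps + 2 * eps powr beta"] q pos g ge
          unfolding G_def mp_def bm_def P_def by blast
        with q show False by simp
      qed
      then have "(\<Sum>q\<in>(t \<rightarrow>\<^sub>E {0, 1}) - G t. mp t q) \<le> (\<Sum>q\<in>(t \<rightarrow>\<^sub>E {0, 1}) - G t. bm t q / g\<^sup>2)"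
        by (rule sum_mono)
      also have "\<dots> \<le> (\<Sum>q\<in>t \<rightarrow>\<^sub>E {0, 1}. bm t q / g\<^sup>2)"
        using finX[OF t] bm0 by (intro sum_mono2) auto
      also have "\<dots> = (\<Sum>q\<in>t \<rightarrow>\<^sub>E {0, 1}. bm t q) / g\<^sup>2" by (simp only: sum_divide_distrib)
      finally have "(\<Sum>q\<in>(t \<rightarrow>\<^sub>E {0, 1}) - G t. mp t q) \<le> (\<Sum>q\<in>t \<rightarrow>\<^sub>E {0, 1}. bm t q) / g\<^sup>2" .
      moreover have "(\<Sum>q\<in>t \<rightarrow>\<^sub>E {0, 1}. mp t q) = 1"
      proof -
        have "(\<Sum>q\<in>t \<rightarrow>\<^sub>E {0, 1}. mp t q) = (\<Sum>q\<in>t \<rightarrow>\<^sub>E {0, 1}. \<Sum>y<2 ^ n. P (merge_idx K t q y))"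
          unfolding mp_def P_def by (intro sum.cong meas_prob_eq_sum[OF tT[OF t] \<open>onb2 M\<close>]) auto
        also have "\<dots> = 1" unfolding sum_merge_idx[OF tT[OF t], symmetric] by (rule P1)
        finally show ?thesis .
      qed
      moreover have "(\<Sum>q\<in>t \<rightarrow>\<^sub>E {0, 1}. mp t q) = (\<Sum>q\<in>(t \<rightarrow>\<^sub>E {0, 1}) - G t. mp t q) + (\<Sum>q\<in>G t. mp t q)"
        by (rule sum.subset_diff[OF sub finX[OF t]])
      ultimately show ?thesis by linarith
    qed
    have total: "(\<Sum>t\<in>T. \<Sum>q\<in>t \<rightarrow>\<^sub>E {0, 1}. bm t q) \<le> C * (eps\<^sup>2 / 2)"
    proof -
      have "(\<Sum>t\<in>T. \<Sum>q\<in>t \<rightarrow>\<^sub>E {0, 1}. bm t q) = (\<Sum>t\<in>T. \<Sum>z<2 ^ K. if bad_sample K n a \<delta> z t then P z else 0)"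
        unfolding bm_def by (intro sum.cong refl sum_bad_mass tT)
      \<comment> \<open>For fixed \<open>z\<close> only the sample is random, so the classical count
        of bad samples applies uniformly in \<open>z\<close> and the weights \<open>P z\<close> sum
        to 1.\<close>
      also have "\<dots> = (\<Sum>z<2 ^ K. \<Sum>t\<in>T. if bad_sample K n a \<delta> z t then P z else 0)"
        by (rule sum.swap)
      also have "\<dots> = (\<Sum>z<2 ^ K. real (card {t \<in> T. bad_sample K n a \<delta> z t}) * P z)"
        using finT by (intro sum.cong refl) (simp add: sum.If_cases Int_def)
      also have "\<dots> \<le> (\<Sum>z<2 ^ K. C * (eps\<^sup>2 / 2) * P z)"
      proof (intro sum_mono mult_right_mono P0)
        fix z
        have "{t \<in> T. bad_sample K n a \<delta> z t} = {t. t \<subseteq> {0..<K} \<and> card t = m \<and> bad_sample K n a \<delta> z t}"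
          by (auto simp: T_def)
        then show "real (card {t \<in> T. bad_sample K n a \<delta> z t}) \<le> C * (eps\<^sup>2 / 2)"
          using card_bad_samples_le[OF \<open>1 \<le> m\<close> \<open>m \<le> n\<close> \<delta>0, of a z, folded K_def, folded C_def, unfolded tail]
          by (simp only:)
      qed
      also have "\<dots> = C * (eps\<^sup>2 / 2)" by (simp only: sum_distrib_left[symmetric] P1 mult_1_right)
      finally show ?thesis .
    qed
    have "epsh powr (1 - 2 * beta) \<ge> eps powr (1 - 2 * beta)"
      using assms by (intro powr_mono2) auto
    moreover have "eps powr (1 - 2 * beta) = eps\<^sup>2 / g\<^sup>2"
    proof -
      have "eps\<^sup>2 = eps powr 2" using assms by simp
      then show ?thesis unfolding g2 by (simp add: powr_diff[symmetric])
    qed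
    \<comment> \<open>The tail bound and Markov's inequality give a failure probability of at most
      \<open>eps\<^sup>2 / 2 / g\<^sup>2\<close>, half of
      \<open>eps powr (1 - 2 * beta)\<close>.\<close>
    moreover have "eps\<^sup>2 / 2 / g\<^sup>2 \<le> eps\<^sup>2 / g\<^sup>2" by (intro divide_right_mono) auto
    ultimately have "1 - epsh powr (1 - 2 * beta) \<le> 1 - eps\<^sup>2 / 2 / g\<^sup>2" by linarith
    also have "\<dots> = (1 / C) * (C - C * (eps\<^sup>2 / 2) / g\<^sup>2)"
      using C by (simp add: field_simps)
    also have "\<dots> \<le> (1 / C) * (C - (\<Sum>t\<in>T. \<Sum>q\<in>t \<rightarrow>\<^sub>E {0, 1}. bm t q) / g\<^sup>2)"
      using C total by (intro mult_left_mono diff_mono divide_right_mono) auto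
    also have "\<dots> = (\<Sum>t\<in>T. (1 / C) * (1 - (\<Sum>q\<in>t \<rightarrow>\<^sub>E {0, 1}. bm t q) / g\<^sup>2))"
      by (simp only: sum_distrib_left[symmetric] sum_subtractf sum_divide_distrib[symmetric] sum_constant cardT mult_1_right)
    also have "\<dots> \<le> (\<Sum>t\<in>T. (1 / C) * (\<Sum>q\<in>G t. mp t q))"
      using C good by (intro sum_mono mult_left_mono) auto
    finally show ?thesis .
  qed
  then show ?thesis
    unfolding Let_def \<delta>_def[symmetric] T_def G_def mp_def C_def K_def .
qed

end
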